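(* Suppose $R$ is a disjoint sum of connected components of the crystal product $R_1\otimes\cdots\otimes R_p$ of $\Phi$-structured and primary posets $R_i$ ($1\le i\le p$). Then $R$ is a crystalline splitting poset and for each $J\subseteq I$ and $\nu=\sum_{j\in J}\nu_j\omega_j^J\in\Lambda_{\Phi_J}^+$ we have $$\chi^{\Phi_J}_\nu\cdot\mathrm{WGF}(R)|_J=\sum_{\mathbf m\in\mathcal M_{J,\nu}(R)}\chi^{\Phi_J}_{\nu+wt^J(\mathbf m)}.$$
   Context: Root systems. $\Phi$ is a finite (reduced, crystallographic) root system in a Euclidean space with simple roots $\{\alpha_i\}_{i\in I}$, $\alpha^\vee=2\alpha/\langle\alpha,\alpha\rangle$, fundamental weights $\omega_i$ dual to simple coroots, $\Lambda=\bigoplus\mathbb Z\omega_i$, $\Lambda^+=\bigoplus\mathbb Z_{\ge0}\omega_i$, Weyl group $W$, $\varrho=\sum\omega_i$. $\mathbb Z[\Lambda]$ is the group ring with basis $\{e^\mu\}$; $\mathcal A(e^\mu)=\sum_{w\in W}\det(w)e^{w(\mu)}$. For $\lambda\in\Lambda^+$ the Weyl bialternant $\chi_\lambda$ is the unique element of $\mathbb Z[\Lambda]$ with $\mathcal A(e^\varrho)\chi_\lambda=\mathcal A(e^{\lambda+\varrho})$. For $J\subseteq I$, $\Phi_J$ is the root subsystem with simple roots $\{\alpha_j\}_{j\in J}$, with fundamental weights $\omega_j^J$, weight lattice $\Lambda_{\Phi_J}$, dominant weights $\Lambda_{\Phi_J}^+$, bialternants $\chi^{\Phi_J}_\nu$.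 For $\mu=\sum m_i\omega_i$ put $\mu^J=\sum_{j\in J}m_j\omega_j^J$, and for $\chi=\sum c_\mu e^\mu$ put $\chi|_J=\sum c_\mu e^{\mu^J}$. Posets. All posets are finite, identified with Hasse diagrams. Ranked means there is a surjection $\rho:R\to\{0,\dots,l\}$ with $\rho(\mathbf s)+1=\rho(\mathbf t)$ whenever $\mathbf s\to\mathbf t$; $l$ is the length. For a ranked poset with Hasse edges colored by $I$, $\mathrm{comp}_i(\mathbf x)$ is the connected component of $\mathbf x$ using only color $i$ edges; $\rho_i(\mathbf x)$ is the rank of $\mathbf x$ there, $l_i(\mathbf x)$ its length, $\delta_i=l_i-\rho_i$, $m_i=\rho_i-\delta_i$, $wt^J(\mathbf x)=\sum_{j\in J}m_j(\mathbf x)\omega_j^J$, $wt=wt^I$, $\mathrm{WGF}(R)=\sum_{\mathbf x}e^{wt(\mathbf x)}$. $R$ is $\Phi$-structured if $wt(\mathbf s)+\alpha_i=wt(\mathbf t)$ whenever $\mathbf s\xrightarrow{i}\mathbf t$; fibrous if every $\mathrm{comp}_i(\mathbf x)$ is a chain. For fibrous $R$, $\mathcal M_{J,\nu}(R)=\{\mathbf m\in R:\delta_j(\mathbf m)\le\nu_j\ \forall j\in J\}$. A $\Phi$-structured fibrous poset $R$ is a crystalline splitting poset if for each $J\subseteq I$ and $\nu\in\Lambda_{\Phi_J}^+$ there is a subset $\mathcal S_{J,\nu}(R)$ of $R$ such that $\nu+wt^J(\mathbf s)\in\Lambda_{\Phi_J}^+$ for all $\mathbf s\in\mathcal S_{J,\nu}(R)$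 and $\chi^{\Phi_J}_\nu\cdot\mathrm{WGF}(R)|_J=\sum_{\mathbf s\in\mathcal S_{J,\nu}(R)}\chi^{\Phi_J}_{\nu+wt^J(\mathbf s)}$. Crystal product: for fibrous $R_1,R_2$, $R_1\otimes R_2$ has vertex set $R_1\times R_2$ with $(\mathbf x_1,\mathbf x_2)\xrightarrow{i}(\mathbf y_1,\mathbf y_2)$ iff either (1) $\mathbf x_1\xrightarrow{i}\mathbf y_1$, $\mathbf x_2=\mathbf y_2$ and $\rho_i(\mathbf x_1)\ge\delta_i(\mathbf x_2)$, or (2) $\mathbf x_1=\mathbf y_1$, $\mathbf x_2\xrightarrow{i}\mathbf y_2$ and $\rho_i(\mathbf x_1)<\delta_i(\mathbf x_2)$. It is a fibrous ranked poset, and $\otimes$ is associative up to natural isomorphism. Primary: a fibrous poset such that whenever $\mathrm{comp}_i(\mathbf x)$ is a chain $\mathbf x_0\xrightarrow{i}\cdots\xrightarrow{i}\mathbf x_\ell$ with $\ell\ge2$, then for all $j\ne i$ and $0\le k\le\ell-1$ we have $\delta_j(\mathbf x_k)=0$ if $l_j(\mathbf x_k)\ge2$. *)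

theory Defs
  imports "HOL-Analysis.Analysis" "HOL-Library.Poly_Mapping"
begin

section \<open>Root systems and weights\<close>

definition coroot :: "real^'n \<Rightarrow> real^'n" where
  "coroot a = (2 / (a \<bullet> a)) *\<^sub>R a"

definition root_reflection :: "real^'n \<Rightarrow> real^'n \<Rightarrow> real^'n" where
  "root_reflection a v = v - (v \<bullet> coroot a) *\<^sub>R a"

text \<open>The ambient Euclidean space of a root system is the span of its roots, which may be a proper
  subspace of the type. So the rank may be 0, and root subsystems live in the same type.\<close>

definition root_system :: "(real^'n) set \<Rightarrow> bool" where
  "root_system \<Phi> \<longleftrightarrow>
     finite \<Phi> \<and> 0 \<notin> \<Phi> \<and>
     (\<forall>a\<in>\<Phi>. root_reflection a ` \<Phi> = \<Phi>) \<and>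
     (\<forall>a\<in>\<Phi>. \<forall>b\<in>\<Phi>. b \<bullet> coroot a \<in> \<int>) \<and>
     (\<forall>a\<in>\<Phi>. \<forall>c::real. c *\<^sub>R a \<in> \<Phi> \<longrightarrow> c = 1 \<or> c = -1)"

definition simple_roots :: "(real^'n) set \<Rightarrow> 'i set \<Rightarrow> ('i \<Rightarrow> real^'n) \<Rightarrow> bool" where
  "simple_roots \<Phi> I \<alpha> \<longleftrightarrow>
     finite I \<and> inj_on \<alpha> I \<and> \<alpha> ` I \<subseteq> \<Phi> \<and> independent (\<alpha> ` I) \<and>
     (\<forall>b\<in>\<Phi>. \<exists>c::'i \<Rightarrow> nat. b = (\<Sum>i\<in>I. real (c i) *\<^sub>R \<alpha> i) \<or>
                                b = - (\<Sum>i\<in>I. real (c i) *\<^sub>R \<alpha> i))"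

text \<open>By linear independence, a root lies in this span iff only the \<open>\<alpha> j\<close> with \<open>j \<in> J\<close> occur in its
  expansion into simple roots.\<close>

definition subsystem :: "(real^'n) set \<Rightarrow> ('i \<Rightarrow> real^'n) \<Rightarrow> 'i set \<Rightarrow> (real^'n) set" where
  "subsystem \<Phi> \<alpha> J = \<Phi> \<inter> span (\<alpha> ` J)"

definition fund_weight :: "('i \<Rightarrow> real^'n) \<Rightarrow> 'i set \<Rightarrow> 'i \<Rightarrow> real^'n" where
  "fund_weight \<alpha> J j =
     (THE w. w \<in> span (\<alpha> ` J) \<and> (\<forall>k\<in>J. w \<bullet> coroot (\<alpha> k) = (if k = j then 1 else 0)))"

definition weight_lattice :: "('i \<Rightarrow> real^'n) \<Rightarrow> 'i set \<Rightarrow> (real^'n) set" where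
  "weight_lattice \<alpha> J = range (\<lambda>m::'i \<Rightarrow> int. \<Sum>j\<in>J. of_int (m j) *\<^sub>R fund_weight \<alpha> J j)"

definition dominant_weight :: "('i \<Rightarrow> real^'n) \<Rightarrow> 'i set \<Rightarrow> ('i \<Rightarrow> nat) \<Rightarrow> real^'n" where
  "dominant_weight \<alpha> J n = (\<Sum>j\<in>J. real (n j) *\<^sub>R fund_weight \<alpha> J j)"

definition dominant_weights :: "('i \<Rightarrow> real^'n) \<Rightarrow> 'i set \<Rightarrow> (real^'n) set" where
  "dominant_weights \<alpha> J = range (dominant_weight \<alpha> J)"

definition weyl_vector :: "('i \<Rightarrow> real^'n) \<Rightarrow> 'i set \<Rightarrow> real^'n" where
  "weyl_vector \<alpha> J = (\<Sum>j\<in>J. fund_weight \<alpha> J j)"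

text \<open>Reflections are involutions, so closing under composition already gives a group.\<close>

inductive_set weyl_group :: "(real^'n) set \<Rightarrow> (real^'n \<Rightarrow> real^'n) set"
  for \<Phi> :: "(real^'n) set" where
  one: "id \<in> weyl_group \<Phi>"
| step: "a \<in> \<Phi> \<Longrightarrow> w \<in> weyl_group \<Phi> \<Longrightarrow> root_reflection a \<circ> w \<in> weyl_group \<Phi>"


section \<open>Weyl bialternants\<close>

text \<open>The group ring \<open>\<int>[\<Lambda>]\<close> is the set of elements of \<open>(real^'n) \<Rightarrow>\<^sub>0 int\<close> (with convolution
  product) supported in the weight lattice, and \<open>e\<^sup>\<mu>\<close> is \<open>Poly_Mapping.single \<mu> 1\<close>.\<close>

text \<open>The determinant of a Weyl group element is \<open>1\<close> or \<open>-1\<close>; the floor only converts it to an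
  integer. Weyl group elements fix the orthogonal complement of the span of the roots, so the
  determinant may be taken on the whole type.\<close>

definition alternant :: "(real^'n) set \<Rightarrow> real^'n \<Rightarrow> (real^'n) \<Rightarrow>\<^sub>0 int" where
  "alternant \<Phi> \<mu> = (\<Sum>w\<in>weyl_group \<Phi>. Poly_Mapping.single (w \<mu>) \<lfloor>det (matrix w)\<rfloor>)"

definition bialternant ::
  "(real^'n) set \<Rightarrow> ('i \<Rightarrow> real^'n) \<Rightarrow> 'i set \<Rightarrow> real^'n \<Rightarrow> (real^'n) \<Rightarrow>\<^sub>0 int" where
  "bialternant \<Phi> \<alpha> J \<nu> =
     (THE \<theta>. Poly_Mapping.keys \<theta> \<subseteq> weight_lattice \<alpha> J \<and>
        alternant (subsystem \<Phi> \<alpha> J) (weyl_vector \<alpha> J) * \<theta> =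
        alternant (subsystem \<Phi> \<alpha> J) (\<nu> + weyl_vector \<alpha> J))"

text \<open>The coefficient of \<open>\<mu>\<close> at the \<open>j\<close>-th fundamental weight is its pairing with the \<open>j\<close>-th simple
  coroot.\<close>

definition weight_restrict :: "('i \<Rightarrow> real^'n) \<Rightarrow> 'i set \<Rightarrow> real^'n \<Rightarrow> real^'n" where
  "weight_restrict \<alpha> J \<mu> = (\<Sum>j\<in>J. (\<mu> \<bullet> coroot (\<alpha> j)) *\<^sub>R fund_weight \<alpha> J j)"

definition ring_restrict ::
  "('i \<Rightarrow> real^'n) \<Rightarrow> 'i set \<Rightarrow> ((real^'n) \<Rightarrow>\<^sub>0 int) \<Rightarrow> (real^'n) \<Rightarrow>\<^sub>0 int" where
  "ring_restrict \<alpha> J \<theta> =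
     (\<Sum>\<mu>\<in>Poly_Mapping.keys \<theta>.
        Poly_Mapping.single (weight_restrict \<alpha> J \<mu>) (Poly_Mapping.lookup \<theta> \<mu>))"


section \<open>Edge-colored posets\<close>

text \<open>A poset is given by its Hasse diagram; \<open>edge R i s t\<close> says that \<open>s\<close> is covered by \<open>t\<close>, by an
  edge of color \<open>i\<close>.\<close>

record ('x, 'i) cposet =
  verts :: "'x set"
  edge :: "'i \<Rightarrow> 'x \<Rightarrow> 'x \<Rightarrow> bool"

definition hasse_edges :: "('x, 'i) cposet \<Rightarrow> ('x \<times> 'x) set" where
  "hasse_edges R = {(s, t). \<exists>i. edge R i s t}"

text \<open>The last two conditions say that the reflexive transitive closure of the edge relation is a
  partial order and that every edge is a covering pair of that order.\<close>

definition colored_poset :: "'i set \<Rightarrow> ('x, 'i) cposet \<Rightarrow> bool" where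
  "colored_poset I R \<longleftrightarrow>
     finite (verts R) \<and>
     (\<forall>i s t. edge R i s t \<longrightarrow> i \<in> I \<and> s \<in> verts R \<and> t \<in> verts R) \<and>
     (\<forall>i j s t. edge R i s t \<longrightarrow> edge R j s t \<longrightarrow> i = j) \<and>
     acyclic (hasse_edges R) \<and>
     (\<forall>(s, t) \<in> hasse_edges R.
        \<not> (\<exists>u. (s, u) \<in> (hasse_edges R)\<^sup>+ \<and> (u, t) \<in> (hasse_edges R)\<^sup>+))"

definition is_rank_function ::
  "'x set \<Rightarrow> ('x \<Rightarrow> 'x \<Rightarrow> bool) \<Rightarrow> ('x \<Rightarrow> nat) \<Rightarrow> nat \<Rightarrow> bool" where
  "is_rank_function V E r l \<longleftrightarrow>
     r ` V = {0..l} \<and> (\<forall>s\<in>V. \<forall>t\<in>V. E s t \<longrightarrow> r s + 1 = r t)"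

definition ranked_poset :: "'i set \<Rightarrow> ('x, 'i) cposet \<Rightarrow> bool" where
  "ranked_poset I R \<longleftrightarrow>
     colored_poset I R \<and> (\<exists>r l. is_rank_function (verts R) (\<lambda>s t. \<exists>i. edge R i s t) r l)"

definition color_edges :: "('x, 'i) cposet \<Rightarrow> 'i \<Rightarrow> ('x \<times> 'x) set" where
  "color_edges R i = {(s, t). edge R i s t}"

definition color_comp :: "('x, 'i) cposet \<Rightarrow> 'i \<Rightarrow> 'x \<Rightarrow> 'x set" where
  "color_comp R i x = {y \<in> verts R. (x, y) \<in> (color_edges R i \<union> (color_edges R i)\<inverse>)\<^sup>*}"

text \<open>The component \<open>color_comp R i x\<close> is connected, so in a ranked poset its rank function is
  unique on it.\<close>

definition color_rank :: "('x, 'i) cposet \<Rightarrow> 'i \<Rightarrow> 'x \<Rightarrow> nat" where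
  "color_rank R i x =
     (THE k. \<exists>r l. is_rank_function (color_comp R i x) (edge R i) r l \<and> k = r x)"

definition color_length :: "('x, 'i) cposet \<Rightarrow> 'i \<Rightarrow> 'x \<Rightarrow> nat" where
  "color_length R i x =
     (THE l. \<exists>r. is_rank_function (color_comp R i x) (edge R i) r l)"

definition color_depth :: "('x, 'i) cposet \<Rightarrow> 'i \<Rightarrow> 'x \<Rightarrow> nat" where
  "color_depth R i x = color_length R i x - color_rank R i x"

definition color_mult :: "('x, 'i) cposet \<Rightarrow> 'i \<Rightarrow> 'x \<Rightarrow> int" where
  "color_mult R i x = int (color_rank R i x) - int (color_depth R i x)"

definition vertex_weight ::
  "('i \<Rightarrow> real^'n) \<Rightarrow> 'i set \<Rightarrow> ('x, 'i) cposet \<Rightarrow> 'x \<Rightarrow> real^'n" where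
  "vertex_weight \<alpha> J R x = (\<Sum>j\<in>J. of_int (color_mult R j x) *\<^sub>R fund_weight \<alpha> J j)"

definition WGF ::
  "('i \<Rightarrow> real^'n) \<Rightarrow> 'i set \<Rightarrow> ('x, 'i) cposet \<Rightarrow> (real^'n) \<Rightarrow>\<^sub>0 int" where
  "WGF \<alpha> I R = (\<Sum>x\<in>verts R. Poly_Mapping.single (vertex_weight \<alpha> I R x) 1)"

text \<open>This is being \<open>\<Phi>\<close>-structured, which depends on \<open>\<Phi>\<close> only through its simple roots.\<close>

definition structured_poset :: "('i \<Rightarrow> real^'n) \<Rightarrow> 'i set \<Rightarrow> ('x, 'i) cposet \<Rightarrow> bool" where
  "structured_poset \<alpha> I R \<longleftrightarrow>
     ranked_poset I R \<and>
     (\<forall>i s t. edge R i s t \<longrightarrow> vertex_weight \<alpha> I R s + \<alpha> i = vertex_weight \<alpha> I R t)"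

definition fibrous_poset :: "'i set \<Rightarrow> ('x, 'i) cposet \<Rightarrow> bool" where
  "fibrous_poset I R \<longleftrightarrow>
     ranked_poset I R \<and>
     (\<forall>i\<in>I. \<forall>x\<in>verts R. \<forall>y\<in>color_comp R i x. \<forall>z\<in>color_comp R i x.
        (y, z) \<in> (color_edges R i)\<^sup>* \<or> (z, y) \<in> (color_edges R i)\<^sup>*)"

definition primary_poset :: "'i set \<Rightarrow> ('x, 'i) cposet \<Rightarrow> bool" where
  "primary_poset I R \<longleftrightarrow>
     fibrous_poset I R \<and>
     (\<forall>i\<in>I. \<forall>x\<in>verts R. \<forall>(c::nat \<Rightarrow> 'x) l.
        color_comp R i x = c ` {0..l} \<longrightarrow> (\<forall>k<l. edge R i (c k) (c (Suc k))) \<longrightarrow> 2 \<le> l \<longrightarrow>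
        (\<forall>j\<in>I - {i}. \<forall>k<l. 2 \<le> color_length R j (c k) \<longrightarrow> color_depth R j (c k) = 0))"

definition M_set :: "'i set \<Rightarrow> ('i \<Rightarrow> nat) \<Rightarrow> ('x, 'i) cposet \<Rightarrow> 'x set" where
  "M_set J n R = {m \<in> verts R. \<forall>j\<in>J. color_depth R j m \<le> n j}"

definition crystalline_splitting ::
  "(real^'n) set \<Rightarrow> ('i \<Rightarrow> real^'n) \<Rightarrow> 'i set \<Rightarrow> ('x, 'i) cposet \<Rightarrow> bool" where
  "crystalline_splitting \<Phi> \<alpha> I R \<longleftrightarrow>
     structured_poset \<alpha> I R \<and> fibrous_poset I R \<and>
     (\<forall>J \<nu>. J \<subseteq> I \<longrightarrow> \<nu> \<in> dominant_weights \<alpha> J \<longrightarrow>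
        (\<exists>S \<subseteq> verts R.
           (\<forall>s\<in>S. \<nu> + vertex_weight \<alpha> J R s \<in> dominant_weights \<alpha> J) \<and>
           bialternant \<Phi> \<alpha> J \<nu> * ring_restrict \<alpha> J (WGF \<alpha> I R) =
             (\<Sum>s\<in>S. bialternant \<Phi> \<alpha> J (\<nu> + vertex_weight \<alpha> J R s))))"


section \<open>Crystal products and disjoint sums of components\<close>

definition relabel :: "('x \<Rightarrow> 'y) \<Rightarrow> ('x, 'i) cposet \<Rightarrow> ('y, 'i) cposet" where
  "relabel f R =
     \<lparr> verts = f ` verts R,
       edge = (\<lambda>i u v. \<exists>x y. edge R i x y \<and> u = f x \<and> v = f y) \<rparr>"

definition crystal_product ::
  "('x, 'i) cposet \<Rightarrow> ('y, 'i) cposet \<Rightarrow> ('x \<times> 'y, 'i) cposet" where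
  "crystal_product R\<^sub>1 R\<^sub>2 =
     \<lparr> verts = verts R\<^sub>1 \<times> verts R\<^sub>2,
       edge = (\<lambda>i (x\<^sub>1, x\<^sub>2) (y\<^sub>1, y\<^sub>2).
         (edge R\<^sub>1 i x\<^sub>1 y\<^sub>1 \<and> x\<^sub>2 \<in> verts R\<^sub>2 \<and> x\<^sub>2 = y\<^sub>2 \<and> color_depth R\<^sub>2 i x\<^sub>2 \<le> color_rank R\<^sub>1 i x\<^sub>1) \<or>
         (x\<^sub>1 \<in> verts R\<^sub>1 \<and> x\<^sub>1 = y\<^sub>1 \<and> edge R\<^sub>2 i x\<^sub>2 y\<^sub>2 \<and> color_rank R\<^sub>1 i x\<^sub>1 < color_depth R\<^sub>2 i x\<^sub>2)) \<rparr>"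

text \<open>Iterated product of a nonempty list of posets, bracketed to the right, with the vertex
  \<open>(x\<^sub>1, (x\<^sub>2, \<dots>))\<close> written as the list \<open>[x\<^sub>1, x\<^sub>2, \<dots>]\<close>. The empty product is unspecified.\<close>

fun crystal_products :: "('x, 'i) cposet list \<Rightarrow> ('x list, 'i) cposet" where
  "crystal_products [R] = relabel (\<lambda>x. [x]) R"
| "crystal_products (R # S # Rs) =
     relabel (\<lambda>(x, xs). x # xs) (crystal_product R (crystal_products (S # Rs)))"

definition connected_comp :: "('x, 'i) cposet \<Rightarrow> 'x \<Rightarrow> ('x, 'i) cposet" where
  "connected_comp R x =
     (let V = {y \<in> verts R. (x, y) \<in> (hasse_edges R \<union> (hasse_edges R)\<inverse>)\<^sup>*}
      in \<lparr> verts = V, edge = (\<lambda>i s t. s \<in> V \<and> t \<in> V \<and> edge R i s t) \<rparr>)"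

definition disjoint_sum :: "('x, 'i) cposet list \<Rightarrow> (nat \<times> 'x, 'i) cposet" where
  "disjoint_sum Cs =
     \<lparr> verts = {(k, x). k < length Cs \<and> x \<in> verts (Cs ! k)},
       edge = (\<lambda>i (k, x) (k', y). k = k' \<and> k < length Cs \<and> edge (Cs ! k) i x y) \<rparr>"

text \<open>Up to isomorphism, \<open>R\<close> is a nonempty disjoint sum of connected components of \<open>T\<close>. Taking
  \<open>f = snd\<close> and distinct components gives the subposets of \<open>T\<close> that are unions of components. The
  empty sum is excluded because a ranked poset is nonempty.\<close>

definition sum_of_components :: "('y, 'i) cposet \<Rightarrow> ('x, 'i) cposet \<Rightarrow> bool" where
  "sum_of_components R T \<longleftrightarrow>
     (\<exists>Cs f. Cs \<noteq> [] \<and> set Cs \<subseteq> connected_comp T ` verts T \<and>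
        inj_on f (verts (disjoint_sum Cs)) \<and> R = relabel f (disjoint_sum Cs))"

end

theory Submission
  imports Defs
begin

text \<open>Write \<open>A(\<mu>)\<close> for the alternant of \<open>e\<^sup>\<mu>\<close>. After multiplication by \<open>A(\<varrho>)\<close>, which is not a zero
  divisor because \<open>\<varrho>\<close> is the unique highest weight in its orbit, the left-hand side becomes
  \<open>A(\<nu> + \<varrho>)\<close> times the weight generating function, that is, the sum of \<open>A(\<nu> + \<varrho> + wt(x))\<close> over all
  vertices \<open>x\<close>, since the Weyl group permutes the weights of a fibrous structured poset. It remains
  to cancel the vertices outside \<open>M_set J n R\<close>. Color each of them by some \<open>j\<close> with \<open>\<delta>\<^sub>j > \<nu>\<^sub>j\<close>. If
  this color is constant on the part \<open>\<delta>\<^sub>j > \<nu>\<^sub>j\<close> of the \<open>j\<close>-string, then reflecting that part, that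
  is, passing to the vertex of the string with \<open>\<delta>\<^sub>j = \<rho>\<^sub>j(x) + \<nu>\<^sub>j + 1\<close>, is an involution that applies a
  simple reflection to \<open>\<nu> + \<varrho> + wt(x)\<close> and so changes the sign of the alternant. In a primary poset
  such a coloring exists because at most one violated string has length at least \<open>2\<close>. In a product,
  color by the first factor where it has a violation for \<open>\<nu>\<close>, and otherwise by the second factor
  with \<open>\<nu>\<close> shifted by the weight of the first. Colorings pass to components because the involution
  never leaves a string.\<close>

section \<open>Reflections and the Weyl group\<close>

text \<open>Being primary need not survive a crystal product, so it cannot serve as the induction
  hypothesis. What survives is \<open>splittable\<close>, a violation coloring for every
  \<open>J\<close> and every bound \<open>n\<close>. All bounds are quantified because the second
  factor is tested against a bound that changes with the vertex of the first. The other inherited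
  notion, \<open>crystal\<close>, records weights through pairings with coroots, which add in
  products, and replaces the global order by local data on strings; the order and the rank function
  are recovered only at the end. \<open>bialternant\<close>, \<open>color_rank\<close> and
  \<open>color_length\<close> are definite descriptions, so existence and uniqueness must come
  first. For bialternants this means that \<open>alternant \<Phi> \<rho>\<close> divides the
  alternant of every lattice weight, which in turn rests on generating \<open>weyl_group\<close>,
  defined by all reflections, by the simple ones. Everything about roots is proved for a whole based
  root system and then applied to the subsystem of \<open>J\<close>.\<close>

lemma root_reflection_eq: "root_reflection a v = v - (2 * (v \<bullet> a) / (a \<bullet> a)) *\<^sub>R a"
  by (simp add: root_reflection_def coroot_def)

lemma linear_root_reflection: "linear (root_reflection a)"
  by (rule linearI)
    (simp_all add: root_reflection_def inner_add_left scaleR_add_left algebra_simps)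

lemma coroot_self: "a \<noteq> 0 \<Longrightarrow> a \<bullet> coroot a = 2"
  by (simp add: coroot_def)

lemma root_reflection_self: "a \<noteq> 0 \<Longrightarrow> root_reflection a a = - a"
  by (simp add: root_reflection_def coroot_self scaleR_2)

lemma root_reflection_idem: "root_reflection a (root_reflection a v) = v"
proof (cases "a = 0")
  case False
  have "root_reflection a v \<bullet> coroot a = - (v \<bullet> coroot a)"
    using coroot_self[OF False] by (simp add: root_reflection_def inner_diff_left)
  then show ?thesis by (simp add: root_reflection_def[of a "root_reflection a v"])
    (simp add: root_reflection_def)
qed (simp add: root_reflection_def)

lemma root_reflection_comp_self: "root_reflection a \<circ> root_reflection a = id"
  by (simp add: fun_eq_iff root_reflection_idem)

lemma root_reflection_inner: "root_reflection a u \<bullet> v = u \<bullet> root_reflection a v"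
  by (simp add: root_reflection_def coroot_def inner_diff_left inner_diff_right inner_commute)

lemma orthogonal_root_reflection: "orthogonal_transformation (root_reflection a)"
  unfolding orthogonal_transformation_def
  using linear_root_reflection[of a] by (simp add: root_reflection_inner root_reflection_idem)

lemma orthogonal_transformation_coroot:
  assumes "orthogonal_transformation f"
  shows "coroot (f a) = f (coroot a)"
  using assms by (simp add: coroot_def orthogonal_transformation_def linear_cmul)

lemma orthogonal_transformation_root_reflection:
  assumes "orthogonal_transformation f"
  shows "f (root_reflection a v) = root_reflection (f a) (f v)"
proof -
  have "linear f" and "\<And>u v. f u \<bullet> f v = u \<bullet> v"
    using assms by (simp_all add: orthogonal_transformation_def)
  then show ?thesis
    using orthogonal_transformation_coroot[OF assms, of a]
    by (simp add: root_reflection_def linear_diff linear_cmul)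
qed

text \<open>An orthogonal map \<open>f\<close> takes the normalized \<open>a\<close> to a coordinate
  axis. Conjugating by \<open>f\<close> turns the reflection into a diagonal matrix with a single
  entry -1 and keeps the determinant.\<close>

lemma det_root_reflection:
  fixes a :: "real^'n"
  assumes "a \<noteq> 0"
  shows "det (matrix (root_reflection a)) = -1"
proof -
  define k :: 'n where "k = undefined"
  define e :: "real^'n" where "e = axis k 1"
  have ne: "norm e = 1" by (simp add: e_def)
  obtain f :: "real^'n \<Rightarrow> real^'n"
    where f: "orthogonal_transformation f" and fa: "f (a /\<^sub>R norm a) = e"
    using orthogonal_transformation_exists_1[of "a /\<^sub>R norm a" e] ne assms by auto
  have lf: "linear f" using f by (simp add: orthogonal_transformation_def)
  have fa': "f a = norm a *\<^sub>R e"
  proof -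
    have "f a = norm a *\<^sub>R f (a /\<^sub>R norm a)"
      using assms by (simp add: linear_cmul[OF lf])
    then show ?thesis using fa by simp
  qed
  have *: "f \<circ> root_reflection a = root_reflection (f a) \<circ> f"
    by (simp add: fun_eq_iff orthogonal_transformation_root_reflection[OF f])
  have dm: "det (matrix (root_reflection (f a))) = -1"
  proof -
    have ve: "v \<bullet> e = v $ k" for v by (simp add: e_def inner_axis)
    have ei: "e $ i = (if i = k then 1 else 0)" for i by (simp add: e_def axis_def)
    have r: "root_reflection (f a) v = (\<chi> i. if i = k then - v $ i else v $ i)" for v
    proof -
      have "root_reflection (f a) v = v - (2 * v $ k) *\<^sub>R e"
        using assms ne by (simp add: fa' root_reflection_eq ve norm_eq_1)
      then show ?thesis by (simp add: vec_eq_iff ei)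
    qed
    have "det (matrix (root_reflection (f a))) =
        (\<Prod>i\<in>UNIV. matrix (root_reflection (f a)) $ i $ i)"
      by (rule det_diagonal) (auto simp: matrix_def r axis_def)
    also have "\<dots> = (\<Prod>i\<in>UNIV. if i = k then -1 else 1)"
      by (rule prod.cong) (auto simp: matrix_def r axis_def)
    finally show ?thesis by simp
  qed
  have "det (matrix f) \<noteq> 0"
    using orthogonal_transformation_det[OF f] by auto
  moreover have "det (matrix f) * det (matrix (root_reflection a)) =
      det (matrix (root_reflection (f a))) * det (matrix f)"
    using arg_cong[OF *, of "\<lambda>g. det (matrix g)"]
    by (simp add: matrix_compose lf linear_root_reflection det_mul)
  ultimately show ?thesis using dm mult_left_cancel[of "det (matrix f)" _ "-1"] by simp
qed

lemma weyl_group_comp: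
  assumes "u \<in> weyl_group \<Phi>" "w \<in> weyl_group \<Phi>"
  shows "u \<circ> w \<in> weyl_group \<Phi>"
  using assms by (induction u) (auto simp: comp_assoc intro: weyl_group.intros)

lemma root_reflection_in_weyl_group: "a \<in> \<Phi> \<Longrightarrow> root_reflection a \<in> weyl_group \<Phi>"
  using weyl_group.step[OF _ weyl_group.one, of a \<Phi>] by simp

lemma weyl_group_orthogonal: "w \<in> weyl_group \<Phi> \<Longrightarrow> orthogonal_transformation w"
  by (induction rule: weyl_group.induct)
    (simp_all add: id_def orthogonal_transformation_compose orthogonal_root_reflection del: comp_apply)

lemma weyl_group_linear: "w \<in> weyl_group \<Phi> \<Longrightarrow> linear w"
  using weyl_group_orthogonal orthogonal_transformation_def by blast

lemma weyl_group_inner: "w \<in> weyl_group \<Phi> \<Longrightarrow> w u \<bullet> w v = u \<bullet> v"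
  using weyl_group_orthogonal orthogonal_transformation_def by blast

lemma weyl_group_det_comp_reflection:
  assumes "w \<in> weyl_group \<Phi>" "a \<noteq> 0"
  shows "det (matrix (w \<circ> root_reflection a)) = - det (matrix w)"
    and "det (matrix (root_reflection a \<circ> w)) = - det (matrix w)"
  using weyl_group_linear[OF assms(1)] linear_root_reflection[of a] det_root_reflection[OF assms(2)]
  by (simp_all add: matrix_compose det_mul)

lemma weyl_group_det:
  assumes "0 \<notin> \<Phi>" "w \<in> weyl_group \<Phi>"
  shows "det (matrix w) = 1 \<or> det (matrix w) = -1"
  using assms(2)
proof (induction)
  case (step a w)
  then have "a \<noteq> 0" using assms(1) by auto
  then show ?case using step weyl_group_det_comp_reflection(2)[of w \<Phi> a]
    by (auto simp del: comp_apply)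
qed (simp add: matrix_id_mat_1 flip: id_def)

text \<open>Reindexing the sum over the group by right multiplication with the reflection flips the
  sign of every determinant.\<close>

lemma alternant_reflection:
  assumes "0 \<notin> \<Phi>" "a \<in> \<Phi>"
  shows "alternant \<Phi> (root_reflection a \<mu>) = - alternant \<Phi> \<mu>"
proof -
  have a: "a \<noteq> 0" using assms by auto
  let ?W = "weyl_group \<Phi>" and ?s = "root_reflection a"
  let ?g = "\<lambda>w. Poly_Mapping.single (w (?s \<mu>)) \<lfloor>det (matrix w)\<rfloor>"
  have bij: "bij_betw (\<lambda>w. w \<circ> ?s) ?W ?W"
    by (rule bij_betw_byWitness[where f' = "\<lambda>w. w \<circ> ?s"])
      (auto simp: comp_assoc root_reflection_comp_self
        intro: weyl_group_comp root_reflection_in_weyl_group[OF assms(2)])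
  have "alternant \<Phi> (?s \<mu>) = (\<Sum>w\<in>?W. ?g (w \<circ> ?s))"
    unfolding alternant_def by (rule sum.reindex_bij_betw[OF bij, symmetric])
  also have "\<dots> = (\<Sum>w\<in>?W. - Poly_Mapping.single (w \<mu>) \<lfloor>det (matrix w)\<rfloor>)"
  proof (rule sum.cong[OF refl])
    fix w assume w: "w \<in> ?W"
    \<comment> \<open>The floor is not an odd function in general; here it is applied to 1 or -1
      only.\<close>
    have "\<lfloor>- det (matrix w)\<rfloor> = - \<lfloor>det (matrix w)\<rfloor>"
      using weyl_group_det[OF assms(1) w] by (auto simp: floor_eq_iff)
    then show "?g (w \<circ> ?s) = - Poly_Mapping.single (w \<mu>) \<lfloor>det (matrix w)\<rfloor>"
      using weyl_group_det_comp_reflection(1)[OF w a]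
      by (simp add: root_reflection_idem single_uminus)
  qed
  finally show ?thesis by (simp add: alternant_def sum_negf)
qed

lemma poly_mapping_int_eq_uminus_iff: "(f :: 'a \<Rightarrow>\<^sub>0 int) = - f \<longleftrightarrow> f = 0"
  by (auto simp: poly_mapping_eq_iff fun_eq_iff)

lemma alternant_fixed:
  assumes "0 \<notin> \<Phi>" "a \<in> \<Phi>" "root_reflection a \<mu> = \<mu>"
  shows "alternant \<Phi> \<mu> = 0"
  using alternant_reflection[OF assms(1,2), of \<mu>] assms(3) poly_mapping_int_eq_uminus_iff by metis

lemma alternant_weyl_group:
  assumes "0 \<notin> \<Phi>" "w \<in> weyl_group \<Phi>"
  shows "alternant \<Phi> (w \<mu>) = alternant \<Phi> \<mu> \<or> alternant \<Phi> (w \<mu>) = - alternant \<Phi> \<mu>"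
  using assms(2)
proof induction
  case (step a w)
  then show ?case using alternant_reflection[OF assms(1) step(1), of "w \<mu>"] by auto
qed simp

lemma weyl_group_roots:
  assumes "root_system \<Phi>" "w \<in> weyl_group \<Phi>" "b \<in> \<Phi>"
  shows "w b \<in> \<Phi>"
  using assms(2,3)
proof (induction arbitrary: b)
  case (step a w)
  then show ?case using assms(1) unfolding root_system_def by fastforce
qed simp

text \<open>Weyl group elements fix the orthogonal complement of the roots pointwise, so they are
  determined by the permutation they induce on the finite set \<open>\<Phi>\<close>.\<close>

lemma finite_weyl_group:
  assumes "root_system \<Phi>"
  shows "finite (weyl_group \<Phi>)"
proof -
  let ?W = "weyl_group \<Phi>"
  have fin: "finite \<Phi>" using assms by (simp add: root_system_def)
  have fixes_perp: "w v = v" if "w \<in> ?W" "\<And>a. a \<in> \<Phi> \<Longrightarrow> v \<bullet> a = 0" for w v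
    using that by induction (simp_all add: root_reflection_eq)
  have inj: "inj_on (\<lambda>w. restrict w \<Phi>) ?W"
  proof (rule inj_onI)
    fix u w assume u: "u \<in> ?W" and w: "w \<in> ?W" and eq: "restrict u \<Phi> = restrict w \<Phi>"
    have "u x = w x" for x
    proof -
      obtain y z where y: "y \<in> span \<Phi>" and z: "\<And>v. v \<in> span \<Phi> \<Longrightarrow> orthogonal z v"
        and x: "x = y + z"
        using orthogonal_subspace_decomp_exists[of \<Phi> x] by blast
      have "u y = w y"
      proof (rule linear_eq_on_span[OF weyl_group_linear[OF u] weyl_group_linear[OF w] _ y])
        show "u a = w a" if "a \<in> \<Phi>" for a using fun_cong[OF eq, of a] that by simp
      qed
      moreover have "u z = z" "w z = z"
        using z by (auto intro!: fixes_perp u w simp: orthogonal_def span_base)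
      ultimately show ?thesis
        by (simp add: x linear_add weyl_group_linear[OF u] weyl_group_linear[OF w])
    qed
    then show "u = w" by (simp add: fun_eq_iff)
  qed
  have "(\<lambda>w. restrict w \<Phi>) ` ?W \<subseteq> \<Phi> \<rightarrow>\<^sub>E \<Phi>"
    using weyl_group_roots[OF assms] by auto
  then have "finite ((\<lambda>w. restrict w \<Phi>) ` ?W)"
    using fin finite_PiE[of \<Phi> "\<lambda>_. \<Phi>"] finite_subset by blast
  then show ?thesis using inj finite_imageD by blast
qed

section \<open>Fundamental weights\<close>

lemma span_orthogonal_eq_zero:
  fixes d :: "'a::euclidean_space"
  assumes "d \<in> span S" "\<And>a. a \<in> S \<Longrightarrow> d \<bullet> a = 0"
  shows "d = 0"
proof -
  have "orthogonal d d"
    using assms by (intro orthogonal_to_span[of d S d]) (auto simp: orthogonal_def)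
  then show ?thesis by (simp add: orthogonal_self)
qed

text \<open>The functional \<open>f\<close> prescribes the inner products with the simple roots; the
  factor 1/2 of the squared length makes the pairing with the coroot equal to 1. Its representing
  vector is projected orthogonally to the span, which leaves these pairings unchanged.\<close>

lemma dual_vector_exists:
  fixes \<alpha> :: "'i \<Rightarrow> real^'n"
  assumes "finite I" "inj_on \<alpha> I" "independent (\<alpha> ` I)"
  shows "\<exists>!w. w \<in> span (\<alpha> ` I) \<and> (\<forall>k\<in>I. w \<bullet> coroot (\<alpha> k) = (if k = j then 1 else 0))"
proof -
  have nz: "\<alpha> k \<noteq> 0" if "k \<in> I" for k
    using assms(3) that dependent_zero by (metis image_eqI)
  obtain f :: "real^'n \<Rightarrow> real" where lf: "linear f"
    and f: "\<forall>x\<in>\<alpha> ` I. f x = (if x = \<alpha> j then x \<bullet> x / 2 else 0)"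
    using linear_independent_extend[OF assms(3), where f = "\<lambda>x. if x = \<alpha> j then x \<bullet> x / 2 else 0"]
    by auto
  define v where "v = adjoint f 1"
  have v: "v \<bullet> x = f x" for x
    using adjoint_works[OF lf, of x 1] by (simp add: v_def inner_commute)
  obtain w z where w: "w \<in> span (\<alpha> ` I)" and z: "\<And>x. x \<in> span (\<alpha> ` I) \<Longrightarrow> orthogonal z x"
    and vwz: "v = w + z"
    using orthogonal_subspace_decomp_exists[of "\<alpha> ` I" v] by blast
  have dual: "w \<bullet> coroot (\<alpha> k) = (if k = j then 1 else 0)" if "k \<in> I" "j \<in> I" for k
  proof -
    have "z \<bullet> \<alpha> k = 0" using z[of "\<alpha> k"] that by (simp add: orthogonal_def span_base)
    then have "w \<bullet> \<alpha> k = f (\<alpha> k)" using v[of "\<alpha> k"] by (simp add: vwz inner_add_left)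
    then show ?thesis
      using f that nz[OF that(1)] inj_onD[OF assms(2), of k j] by (auto simp: coroot_def)
  qed
  \<comment> \<open>For \<open>j\<close> outside \<open>I\<close> all required pairings are 0, and
    the zero vector has them.\<close>
  define u where "u = (if j \<in> I then w else 0)"
  have u: "u \<in> span (\<alpha> ` I)" "\<And>k. k \<in> I \<Longrightarrow> u \<bullet> coroot (\<alpha> k) = (if k = j then 1 else 0)"
    using w dual by (auto simp: u_def span_zero)
  show ?thesis
  proof (rule ex1I[of _ u])
    fix u' assume u': "u' \<in> span (\<alpha> ` I) \<and> (\<forall>k\<in>I. u' \<bullet> coroot (\<alpha> k) = (if k = j then 1 else 0))"
    have "u' - u = 0"
    proof (rule span_orthogonal_eq_zero)
      show "u' - u \<in> span (\<alpha> ` I)" using u u' span_diff by blast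
      fix a assume "a \<in> \<alpha> ` I"
      then obtain k where k: "k \<in> I" "a = \<alpha> k" by blast
      then have "(u' - u) \<bullet> coroot (\<alpha> k) = 0" using u u' by (simp add: inner_diff_left)
      then show "(u' - u) \<bullet> a = 0" using nz[OF k(1)] by (simp add: coroot_def k(2))
    qed
    then show "u' = u" by simp
  qed (use u in auto)
qed

locale based_root_system =
  fixes \<Phi> :: "(real^'n) set" and I :: "'i set" and \<alpha> :: "'i \<Rightarrow> real^'n"
  assumes root_system: "root_system \<Phi>" and simple_roots: "simple_roots \<Phi> I \<alpha>"
begin

abbreviation "\<omega> \<equiv> fund_weight \<alpha> I"
abbreviation "\<rho> \<equiv> weyl_vector \<alpha> I"
abbreviation "W \<equiv> weyl_group \<Phi>"
abbreviation "s j \<equiv> root_reflection (\<alpha> j)"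

lemma finite_I: "finite I" and inj_simple: "inj_on \<alpha> I" and simple_in: "j \<in> I \<Longrightarrow> \<alpha> j \<in> \<Phi>"
  and independent_simple: "independent (\<alpha> ` I)"
  using simple_roots by (auto simp: simple_roots_def)

lemma zero_notin: "0 \<notin> \<Phi>" using root_system by (simp add: root_system_def)

lemma simple_nonzero: "j \<in> I \<Longrightarrow> \<alpha> j \<noteq> 0"
  using simple_in zero_notin by metis

lemma
  shows fund_weight_span: "\<omega> j \<in> span (\<alpha> ` I)"
    and fund_weight_coroot: "k \<in> I \<Longrightarrow> \<omega> j \<bullet> coroot (\<alpha> k) = (if k = j then 1 else 0)"
  using theI'[OF dual_vector_exists[OF finite_I inj_simple independent_simple, of j]]
  by (auto simp: fund_weight_def)

lemma simple_fund_weight: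
  "k \<in> I \<Longrightarrow> \<alpha> k \<bullet> \<omega> j = (if k = j then (\<alpha> k \<bullet> \<alpha> k) / 2 else 0)"
  using fund_weight_coroot[of k j] simple_nonzero[of k]
  by (auto simp: coroot_def inner_commute field_simps)

lemma weight_coroot:
  "k \<in> I \<Longrightarrow> (\<Sum>j\<in>I. c j *\<^sub>R \<omega> j) \<bullet> coroot (\<alpha> k) = c k"
  using finite_I by (simp add: inner_sum_left fund_weight_coroot if_distrib cong: if_cong)

lemma weyl_vector_coroot: "k \<in> I \<Longrightarrow> \<rho> \<bullet> coroot (\<alpha> k) = 1"
  using weight_coroot[of k "\<lambda>_. 1"] by (simp add: weyl_vector_def)

lemma simple_weyl_vector_pos: "k \<in> I \<Longrightarrow> \<alpha> k \<bullet> \<rho> > 0"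
  using weyl_vector_coroot[of k] simple_nonzero[of k] inner_gt_zero_iff[of "\<alpha> k"]
  by (simp add: coroot_def inner_commute field_simps)

lemma inner_weyl_vector: "v \<bullet> \<rho> = (\<Sum>j\<in>I. v \<bullet> \<omega> j)"
  by (simp add: weyl_vector_def inner_sum_right)

lemma span_coeffs: "v \<in> span (\<alpha> ` I) \<Longrightarrow> \<exists>c. v = (\<Sum>i\<in>I. c i *\<^sub>R \<alpha> i)"
  using finite_I by (auto simp: span_finite sum.reindex[OF inj_simple])

lemma span_eq_zero:
  assumes "v \<in> span (\<alpha> ` I)" "\<And>k. k \<in> I \<Longrightarrow> v \<bullet> \<omega> k = 0"
  shows "v = 0"
proof -
  obtain c where c: "v = (\<Sum>i\<in>I. c i *\<^sub>R \<alpha> i)" using span_coeffs[OF assms(1)] by blast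
  have "c k = 0" if "k \<in> I" for k
  proof -
    have "v \<bullet> \<omega> k = c k * ((\<alpha> k \<bullet> \<alpha> k) / 2)"
      using that finite_I
      by (simp add: c inner_sum_left simple_fund_weight if_distrib cong: if_cong)
    then show ?thesis using assms(2)[OF that] simple_nonzero[OF that] by simp
  qed
  then show ?thesis by (simp add: c)
qed

lemma span_coroot_expansion:
  assumes "v \<in> span (\<alpha> ` I)"
  shows "v = (\<Sum>j\<in>I. (v \<bullet> coroot (\<alpha> j)) *\<^sub>R \<omega> j)"
proof -
  define d where "d = v - (\<Sum>j\<in>I. (v \<bullet> coroot (\<alpha> j)) *\<^sub>R \<omega> j)"
  have "d \<bullet> coroot (\<alpha> k) = 0" if "k \<in> I" for k
    using weight_coroot[OF that] by (simp add: d_def inner_diff_left)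
  then have "d \<bullet> \<alpha> k = 0" if "k \<in> I" for k
    using that simple_nonzero[OF that] by (force simp: coroot_def)
  moreover have "d \<in> span (\<alpha> ` I)"
    using assms by (auto simp: d_def intro!: span_diff span_sum span_scale fund_weight_span)
  ultimately have "d = 0" by (intro span_orthogonal_eq_zero[of d "\<alpha> ` I"]) auto
  then show ?thesis by (simp add: d_def)
qed

section \<open>Positive roots and the exchange property\<close>

text \<open>Pairing with \<open>\<omega> k\<close> gives a positive multiple of the coefficient of
  \<open>\<alpha> k\<close>. On the span of the simple roots this is therefore nonnegativity of all
  coefficients.\<close>

definition positive :: "real^'n \<Rightarrow> bool" where
  "positive v \<longleftrightarrow> (\<forall>k\<in>I. v \<bullet> \<omega> k \<ge> 0)"

lemma root_coeffs:
  "b \<in> \<Phi> \<Longrightarrow> \<exists>c::'i \<Rightarrow> nat. b = (\<Sum>i\<in>I. real (c i) *\<^sub>R \<alpha> i) \<or>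
                               b = - (\<Sum>i\<in>I. real (c i) *\<^sub>R \<alpha> i)"
  using simple_roots by (simp add: simple_roots_def)

lemma root_span: "b \<in> \<Phi> \<Longrightarrow> b \<in> span (\<alpha> ` I)"
proof -
  assume "b \<in> \<Phi>"
  then obtain c :: "'i \<Rightarrow> nat" where
    "b = (\<Sum>i\<in>I. real (c i) *\<^sub>R \<alpha> i) \<or> b = - (\<Sum>i\<in>I. real (c i) *\<^sub>R \<alpha> i)"
    using root_coeffs by blast
  then show ?thesis by (auto intro!: span_neg span_sum span_scale intro: span_base)
qed

lemma sum_simple_positive:
  assumes "\<And>i. i \<in> I \<Longrightarrow> c i \<ge> 0"
  shows "positive (\<Sum>i\<in>I. c i *\<^sub>R \<alpha> i)"
  unfolding positive_def
  using assms by (auto simp: inner_sum_left simple_fund_weight intro!: sum_nonneg)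

lemma simple_positive: "k \<in> I \<Longrightarrow> positive (\<alpha> k)"
  by (simp add: positive_def simple_fund_weight)

lemma root_positive_or_negative:
  assumes "b \<in> \<Phi>"
  shows "positive b \<or> positive (- b)"
proof -
  obtain c :: "'i \<Rightarrow> nat" where
    "b = (\<Sum>i\<in>I. real (c i) *\<^sub>R \<alpha> i) \<or> b = - (\<Sum>i\<in>I. real (c i) *\<^sub>R \<alpha> i)"
    using root_coeffs[OF assms] by blast
  then show ?thesis using sum_simple_positive[of "\<lambda>i. real (c i)"] by auto
qed

lemma positive_weyl_vector:
  assumes "v \<in> span (\<alpha> ` I)" "positive v" "v \<noteq> 0"
  shows "v \<bullet> \<rho> > 0"
proof -
  obtain k where "k \<in> I" "v \<bullet> \<omega> k \<noteq> 0" using span_eq_zero assms by blast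
  then show ?thesis
    unfolding inner_weyl_vector using assms(2) finite_I
    by (intro sum_pos2[of _ k]) (auto simp: positive_def less_le)
qed

lemma root_reflection_root: "a \<in> \<Phi> \<Longrightarrow> b \<in> \<Phi> \<Longrightarrow> root_reflection a b \<in> \<Phi>"
  using root_system by (fastforce simp: root_system_def)

lemma neg_root: "b \<in> \<Phi> \<Longrightarrow> - b \<in> \<Phi>"
  using root_reflection_root[of b b] root_reflection_self[of b] zero_notin by metis

text \<open>The reflection alters only the coefficient of \<open>\<alpha> j\<close>. If the image
  were negative, all other coefficients of \<open>b\<close> would vanish, and a positive root
  proportional to \<open>\<alpha> j\<close> is \<open>\<alpha> j\<close> because the system is
  reduced.\<close>

lemma simple_reflection_positive:
  assumes "b \<in> \<Phi>" "positive b" "j \<in> I" "b \<noteq> \<alpha> j"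
  shows "positive (s j b)"
proof (rule ccontr)
  assume np: "\<not> positive (s j b)"
  have sb: "s j b \<in> \<Phi>" using assms root_reflection_root simple_in by blast
  then have neg: "positive (- s j b)" using root_positive_or_negative np by blast
  have z: "b \<bullet> \<omega> k = 0" if "k \<in> I" "k \<noteq> j" for k
  proof -
    have "s j b \<bullet> \<omega> k = b \<bullet> \<omega> k"
      using that assms(3) by (simp add: root_reflection_def inner_diff_left simple_fund_weight)
    then show ?thesis using neg assms(2) that by (force simp: positive_def)
  qed
  define c where "c = (b \<bullet> \<omega> j) / (\<alpha> j \<bullet> \<omega> j)"
  have jj: "\<alpha> j \<bullet> \<omega> j > 0" using simple_fund_weight[OF assms(3)] simple_nonzero[OF assms(3)] by simp
  have "b - c *\<^sub>R \<alpha> j = 0"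
  proof (rule span_eq_zero)
    show "b - c *\<^sub>R \<alpha> j \<in> span (\<alpha> ` I)"
      using assms root_span by (auto intro!: span_diff span_scale simple_in)
    show "(b - c *\<^sub>R \<alpha> j) \<bullet> \<omega> k = 0" if "k \<in> I" for k
      using z[OF that] jj simple_fund_weight[OF assms(3), of k]
      by (cases "k = j") (auto simp: c_def inner_diff_left)
  qed
  then have bc: "b = c *\<^sub>R \<alpha> j" by simp
  then have "c = 1 \<or> c = -1"
    using root_system simple_in[OF assms(3)] assms(1) unfolding root_system_def by metis
  moreover have "c \<ge> 0" using assms(2,3) jj by (simp add: c_def positive_def)
  ultimately show False using bc assms(4) by auto
qed

section \<open>Words in simple reflections\<close>

fun word :: "'i list \<Rightarrow> real^'n \<Rightarrow> real^'n" where
  "word [] = id"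
| "word (j # js) = s j \<circ> word js"

lemma word_append: "word (js @ ks) = word js \<circ> word ks"
  by (induction js) (auto simp: comp_assoc)

lemma word_in_W: "set js \<subseteq> I \<Longrightarrow> word js \<in> W"
  by (induction js) (auto intro: weyl_group.intros simple_in)

text \<open>Reading the word from the right, some letter \<open>i\<close> first makes the image of
  \<open>\<alpha> j\<close> non-positive. Just before it the image is \<open>\<alpha> i\<close>, so
  moving \<open>s j\<close> to the left through the rest of the word turns it into
  \<open>s i\<close>, which cancels that letter.\<close>

lemma word_exchange:
  assumes "set js \<subseteq> I" "j \<in> I" "\<not> positive (word js (\<alpha> j))"
  shows "\<exists>js'. set js' \<subseteq> I \<and> length js' < length js \<and> word js' = word js \<circ> s j"
  using assms
proof (induction js)
  case Nil
  then show ?case using simple_positive by simp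
next
  case (Cons i js)
  have w: "word js \<in> W" using Cons.prems by (auto intro: word_in_W)
  show ?case
  proof (cases "positive (word js (\<alpha> j))")
    case False
    then obtain js' where "set js' \<subseteq> I" "length js' < length js" "word js' = word js \<circ> s j"
      using Cons.IH[OF _ Cons.prems(2)] Cons.prems(1) by (meson set_subset_Cons subset_trans)
    then show ?thesis using Cons.prems(1)
      by (intro exI[of _ "i # js'"]) (simp add: comp_assoc del: comp_apply)
  next
    case True
    have "word js (\<alpha> j) = \<alpha> i"
      using simple_reflection_positive[OF weyl_group_roots[OF root_system w] True, of i]
        Cons.prems simple_in by auto
    then have "word js \<circ> s j = s i \<circ> word js"
      by (simp add: fun_eq_iff orthogonal_transformation_root_reflection[OF weyl_group_orthogonal[OF w]])
    then have "word (i # js) \<circ> s j = word js"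
      by (simp add: comp_assoc) (simp add: root_reflection_comp_self flip: comp_assoc)
    then show ?thesis using Cons.prems by (intro exI[of _ js]) (auto simp del: comp_apply)
  qed
qed

text \<open>Conjugating by a simple reflection with \<open>b \<bullet> \<alpha> j > 0\<close> lowers
  the height \<open>b \<bullet> \<rho>\<close>. Counting the roots of smaller height makes this a
  natural number to induct on.\<close>

lemma positive_root_reflection_word:
  assumes "b \<in> \<Phi>" "positive b"
  shows "\<exists>js. set js \<subseteq> I \<and> word js = root_reflection b"
  using assms
proof (induction "card {a \<in> \<Phi>. a \<bullet> \<rho> < b \<bullet> \<rho>}" arbitrary: b rule: less_induct)
  case less
  have fin: "finite \<Phi>" using root_system by (simp add: root_system_def)
  have bs: "b \<in> span (\<alpha> ` I)" and b0: "b \<noteq> 0" using less.prems root_span zero_notin by auto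
  \<comment> \<open>If no simple root had positive inner product with \<open>b\<close>, expanding
    one factor of \<open>b \<bullet> b\<close> in simple roots with nonnegative coefficients would
    give \<open>b \<bullet> b \<le> 0\<close>.\<close>
  obtain j where j: "j \<in> I" "b \<bullet> \<alpha> j > 0"
  proof (rule ccontr)
    assume "\<not> thesis"
    then have nonpos: "b \<bullet> \<alpha> j \<le> 0" if "j \<in> I" for j using that \<open>_ \<Longrightarrow> _ \<Longrightarrow> thesis\<close> by force
    obtain c where c: "b = (\<Sum>i\<in>I. c i *\<^sub>R \<alpha> i)" using span_coeffs[OF bs] by blast
    have "c k \<ge> 0" if "k \<in> I" for k
    proof -
      have "b \<bullet> \<omega> k = c k * ((\<alpha> k \<bullet> \<alpha> k) / 2)"
        using that finite_I
        by (subst c) (simp add: inner_sum_left simple_fund_weight if_distrib cong: if_cong)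
      then have "c k = 2 * (b \<bullet> \<omega> k) / (\<alpha> k \<bullet> \<alpha> k)" using simple_nonzero[OF that] by (simp add: field_simps)
      then show ?thesis using less.prems(2) that by (simp add: positive_def)
    qed
    moreover have "b \<bullet> b = (\<Sum>i\<in>I. c i * (b \<bullet> \<alpha> i))"
      by (subst (2) c) (simp add: inner_sum_right)
    ultimately have "b \<bullet> b \<le> 0" using nonpos by (auto intro!: sum_nonpos mult_nonneg_nonpos)
    then show False using b0 by (meson inner_gt_zero_iff not_le)
  qed
  show ?case
  proof (cases "b = \<alpha> j")
    case True
    then show ?thesis using j by (intro exI[of _ "[j]"]) auto
  next
    case False
    let ?b = "s j b"
    have rb: "?b \<in> \<Phi>" using less.prems j root_reflection_root simple_in by blast
    have lt: "?b \<bullet> \<rho> < b \<bullet> \<rho>"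
      using j simple_weyl_vector_pos[of j] simple_nonzero[of j]
      by (simp add: root_reflection_eq inner_diff_left)
    have "card {a \<in> \<Phi>. a \<bullet> \<rho> < ?b \<bullet> \<rho>} < card {a \<in> \<Phi>. a \<bullet> \<rho> < b \<bullet> \<rho>}"
      using lt rb fin by (intro psubset_card_mono) auto
    then obtain js where js: "set js \<subseteq> I" "word js = root_reflection ?b"
      using less.hyps[OF _ rb simple_reflection_positive] less.prems j False by blast
    have "word ([j] @ js @ [j]) = root_reflection b"
      using js(2) orthogonal_transformation_root_reflection[OF orthogonal_root_reflection, of "\<alpha> j" ?b]
      unfolding word_append by (simp add: fun_eq_iff root_reflection_idem)
    then show ?thesis using js j by (intro exI[of _ "[j] @ js @ [j]"]) auto
  qed
qed

lemma weyl_group_word: "w \<in> W \<Longrightarrow> \<exists>js. set js \<subseteq> I \<and> w = word js"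
proof (induction rule: weyl_group.induct)
  case one
  show ?case by (intro exI[of _ "[]"]) auto
next
  case (step b w)
  then obtain js where js: "set js \<subseteq> I" "w = word js" by blast
  have "root_reflection (- b) = root_reflection b" by (simp add: fun_eq_iff root_reflection_eq)
  then obtain ks where "set ks \<subseteq> I" "word ks = root_reflection b"
    using positive_root_reflection_word[of b] positive_root_reflection_word[of "- b"]
      root_positive_or_negative[of b] neg_root[of b] step by auto
  then show ?case using js by (intro exI[of _ "ks @ js"]) (auto simp: word_append)
qed

text \<open>The step may assume that \<open>w (\<alpha> j)\<close> is positive, since otherwise the
  exchange property replaces the word by a shorter one. This sign is what makes the monotonicity
  arguments along Weyl orbits work.\<close>

lemma weyl_group_induct [consumes 1, case_names id step]:
  assumes "w \<in> W" and "P id"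
    and step: "\<And>w j. w \<in> W \<Longrightarrow> P w \<Longrightarrow> j \<in> I \<Longrightarrow> positive (w (\<alpha> j)) \<Longrightarrow> P (w \<circ> s j)"
  shows "P w"
proof -
  have "P (word js)" if "set js \<subseteq> I" for js
    using that
  proof (induction "length js" arbitrary: js rule: less_induct)
    case less
    show ?case
    proof (cases js rule: rev_cases)
      case Nil
      then show ?thesis using assms by (simp add: id_def)
    next
      case (snoc ks j)
      have ks: "set ks \<subseteq> I" "j \<in> I" using less.prems snoc by auto
      show ?thesis
      proof (cases "positive (word ks (\<alpha> j))")
        case True
        then show ?thesis using less.hyps[of ks] ks snoc step[OF word_in_W] by (simp add: word_append)
      next
        case False
        then obtain js' where "set js' \<subseteq> I" "length js' < length ks" "word js' = word ks \<circ> s j"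
          using word_exchange ks by blast
        then show ?thesis using less.hyps[of js'] snoc by (simp add: word_append)
      qed
    qed
  qed
  then show ?thesis using weyl_group_word[OF assms(1)] by blast
qed

end

section \<open>Leading terms: how the Weyl group lowers dominant weights\<close>

lemma lookup_single_mult:
  fixes \<theta> :: "'a::ab_group_add \<Rightarrow>\<^sub>0 'b::comm_semiring_1"
  shows "Poly_Mapping.lookup (Poly_Mapping.single a c * \<theta>) k = c * Poly_Mapping.lookup \<theta> (k - a)"
proof -
  have "(k = a + q) = (q = k - a)" for q by (auto simp: algebra_simps)
  then show ?thesis by (simp add: lookup_mult lookup_single when_mult)
qed

context based_root_system
begin

text \<open>Each induction step adds to the difference the positive root
  \<open>w (\<alpha> j)\<close> with the nonnegative factor
  \<open>\<nu> \<bullet> coroot (\<alpha> j)\<close>.\<close>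

lemma dominant_minus_image:
  assumes "w \<in> W" and "\<And>j. j \<in> I \<Longrightarrow> \<nu> \<bullet> coroot (\<alpha> j) \<ge> 0"
  shows "\<nu> - w \<nu> \<in> span (\<alpha> ` I) \<and> positive (\<nu> - w \<nu>)"
  using assms(1)
proof (induction rule: weyl_group_induct)
  case id
  then show ?case by (simp add: span_zero positive_def)
next
  case (step w j)
  let ?c = "\<nu> \<bullet> coroot (\<alpha> j)"
  have lin: "linear w" using step weyl_group_linear by blast
  have eq: "\<nu> - (w \<circ> s j) \<nu> = (\<nu> - w \<nu>) + ?c *\<^sub>R w (\<alpha> j)"
    by (simp add: root_reflection_def linear_diff[OF lin] linear_cmul[OF lin])
  have "w (\<alpha> j) \<in> span (\<alpha> ` I)"
    using step weyl_group_roots[OF root_system] simple_in root_span by blast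
  moreover have "?c \<ge> 0" using assms(2) step by blast
  ultimately show ?case
    unfolding eq using step by (auto simp: positive_def inner_add_left intro: span_add span_scale)
qed

text \<open>For \<open>\<rho>\<close> this factor is 1, so every step strictly lowers the pairing
  with \<open>\<rho>\<close>.\<close>

lemma weyl_vector_image_less:
  assumes "w \<in> W"
  shows "w = id \<or> w \<rho> \<bullet> \<rho> < \<rho> \<bullet> \<rho>"
  using assms
proof (induction rule: weyl_group_induct)
  case (step w j)
  have lin: "linear w" using step weyl_group_linear by blast
  have root: "w (\<alpha> j) \<in> \<Phi>" using step weyl_group_roots[OF root_system] simple_in by blast
  then have "w (\<alpha> j) \<bullet> \<rho> > 0"
    using positive_weyl_vector[OF root_span] step zero_notin by metis
  moreover have "(w \<circ> s j) \<rho> = w \<rho> - w (\<alpha> j)"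
    using step by (simp add: root_reflection_def weyl_vector_coroot linear_diff[OF lin])
  moreover have "w \<rho> \<bullet> \<rho> \<le> \<rho> \<bullet> \<rho>" using step by auto
  ultimately show ?case by (simp add: inner_diff_left)
qed simp

section \<open>Existence and uniqueness of bialternants\<close>

text \<open>A leading term argument: if \<open>\<gamma>\<close> is a highest weight of the
  difference, only the identity of the group contributes to the coefficient at
  \<open>\<rho> + \<gamma>\<close>, because for any other \<open>w\<close> the required weight of
  the difference would lie above \<open>\<gamma>\<close>.\<close>

lemma alternant_weyl_vector_mult_cancel:
  assumes "alternant \<Phi> \<rho> * \<theta>\<^sub>1 = alternant \<Phi> \<rho> * \<theta>\<^sub>2"
  shows "\<theta>\<^sub>1 = \<theta>\<^sub>2"
proof (rule ccontr)
  define \<theta> where "\<theta> = \<theta>\<^sub>1 - \<theta>\<^sub>2"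
  assume "\<theta>\<^sub>1 \<noteq> \<theta>\<^sub>2"
  then have "Poly_Mapping.keys \<theta> \<noteq> {}" by (simp add: \<theta>_def)
  then obtain \<gamma> where \<gamma>: "\<gamma> \<in> Poly_Mapping.keys \<theta>"
    and max: "\<And>\<mu>. \<mu> \<in> Poly_Mapping.keys \<theta> \<Longrightarrow> \<mu> \<bullet> \<rho> \<le> \<gamma> \<bullet> \<rho>"
    using ex_is_arg_min_if_finite[OF finite_keys, of \<theta> "\<lambda>\<mu>. - (\<mu> \<bullet> \<rho>)"]
    by (auto simp: is_arg_min_linorder)
  have "0 = Poly_Mapping.lookup (alternant \<Phi> \<rho> * \<theta>) (\<rho> + \<gamma>)"
    using assms by (simp add: \<theta>_def right_diff_distrib)
  also have "\<dots> = (\<Sum>w\<in>W. \<lfloor>det (matrix w)\<rfloor> * Poly_Mapping.lookup \<theta> (\<rho> + \<gamma> - w \<rho>))"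
    by (simp add: alternant_def sum_distrib_right lookup_sum lookup_single_mult)
  also have "\<dots> = (\<Sum>w\<in>W. if w = id then Poly_Mapping.lookup \<theta> \<gamma> else 0)"
  proof (rule sum.cong[OF refl])
    fix w assume w: "w \<in> W"
    have "Poly_Mapping.lookup \<theta> (\<rho> + \<gamma> - w \<rho>) = 0" if "w \<noteq> id"
    proof -
      have "(\<rho> + \<gamma> - w \<rho>) \<bullet> \<rho> > \<gamma> \<bullet> \<rho>"
        using weyl_vector_image_less[OF w] that by (simp add: inner_add_left inner_diff_left)
      then show ?thesis using max by (meson in_keys_iff not_less)
    qed
    then show "\<lfloor>det (matrix w)\<rfloor> * Poly_Mapping.lookup \<theta> (\<rho> + \<gamma> - w \<rho>) = (if w = id then Poly_Mapping.lookup \<theta> \<gamma> else 0)"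
      by (auto simp: matrix_id_mat_1 simp flip: id_def)
  qed
  also have "\<dots> = Poly_Mapping.lookup \<theta> \<gamma>"
    using finite_weyl_group[OF root_system] weyl_group.one[of \<Phi>] by simp
  finally show False using \<gamma> by (simp add: in_keys_iff)
qed

text \<open>Quantifying over all \<open>F\<close> expresses that the family \<open>f\<close> is
  invariant with multiplicities under simple reflections. For each \<open>w\<close> the summands
  \<open>f x\<close> may then be replaced by \<open>w (f x)\<close>, which combines with
  \<open>w \<mu>\<close> by linearity.\<close>

lemma alternant_mult_invariant:
  assumes "\<And>j F. j \<in> I \<Longrightarrow> (\<Sum>x\<in>X. F (s j (f x))) = (\<Sum>x\<in>X. F (f x) :: (real^'n) \<Rightarrow>\<^sub>0 int)"
  shows "alternant \<Phi> \<mu> * (\<Sum>x\<in>X. Poly_Mapping.single (f x) 1) = (\<Sum>x\<in>X. alternant \<Phi> (\<mu> + f x))"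
proof -
  have inv: "(\<Sum>x\<in>X. F (w (f x))) = (\<Sum>x\<in>X. F (f x))" if "w \<in> W" for w and F :: "_ \<Rightarrow> (real^'n) \<Rightarrow>\<^sub>0 int"
    using that
  proof (induction arbitrary: F rule: weyl_group_induct)
    case (step w j)
    have "(\<Sum>x\<in>X. F ((w \<circ> s j) (f x))) = (\<Sum>x\<in>X. (F \<circ> w) (s j (f x)))" by simp
    also have "\<dots> = (\<Sum>x\<in>X. (F \<circ> w) (f x))" using assms[OF \<open>j \<in> I\<close>] .
    finally show ?case using step by simp
  qed simp
  let ?d = "\<lambda>w. \<lfloor>det (matrix w)\<rfloor>"
  have "alternant \<Phi> \<mu> * (\<Sum>x\<in>X. Poly_Mapping.single (f x) 1) =
      (\<Sum>w\<in>W. \<Sum>x\<in>X. Poly_Mapping.single (w \<mu> + f x) (?d w))"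
    by (simp add: alternant_def sum_product mult_single)
  also have "\<dots> = (\<Sum>w\<in>W. \<Sum>x\<in>X. Poly_Mapping.single (w \<mu> + w (f x)) (?d w))"
    by (rule sum.cong[OF refl], rule inv[symmetric])
  also have "\<dots> = (\<Sum>w\<in>W. \<Sum>x\<in>X. Poly_Mapping.single (w (\<mu> + f x)) (?d w))"
    by (intro sum.cong refl) (simp add: linear_add[OF weyl_group_linear])
  also have "\<dots> = (\<Sum>x\<in>X. alternant \<Phi> (\<mu> + f x))"
    by (subst sum.swap) (simp add: alternant_def)
  finally show ?thesis .
qed

section \<open>The weight lattice and divisibility of alternants\<close>

lemma weight_lattice_iff:
  "\<mu> \<in> weight_lattice \<alpha> I \<longleftrightarrow> \<mu> \<in> span (\<alpha> ` I) \<and> (\<forall>k\<in>I. \<mu> \<bullet> coroot (\<alpha> k) \<in> \<int>)"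
proof
  assume "\<mu> \<in> weight_lattice \<alpha> I"
  then obtain m :: "'i \<Rightarrow> int" where m: "\<mu> = (\<Sum>j\<in>I. of_int (m j) *\<^sub>R \<omega> j)"
    by (auto simp: weight_lattice_def)
  then show "\<mu> \<in> span (\<alpha> ` I) \<and> (\<forall>k\<in>I. \<mu> \<bullet> coroot (\<alpha> k) \<in> \<int>)"
    by (auto simp: weight_coroot intro!: span_sum span_scale fund_weight_span)
next
  assume r: "\<mu> \<in> span (\<alpha> ` I) \<and> (\<forall>k\<in>I. \<mu> \<bullet> coroot (\<alpha> k) \<in> \<int>)"
  define m where "m k = \<lfloor>\<mu> \<bullet> coroot (\<alpha> k)\<rfloor>" for k
  have "\<mu> = (\<Sum>j\<in>I. (\<mu> \<bullet> coroot (\<alpha> j)) *\<^sub>R \<omega> j)" using r span_coroot_expansion by blast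
  also have "\<dots> = (\<Sum>j\<in>I. of_int (m j) *\<^sub>R \<omega> j)"
    by (rule sum.cong) (use r in \<open>auto simp: m_def\<close>)
  finally show "\<mu> \<in> weight_lattice \<alpha> I" by (auto simp: weight_lattice_def)
qed

lemma weight_lattice_diff:
  "\<mu> \<in> weight_lattice \<alpha> I \<Longrightarrow> \<nu> \<in> weight_lattice \<alpha> I \<Longrightarrow> \<mu> - \<nu> \<in> weight_lattice \<alpha> I"
  by (auto simp: weight_lattice_iff inner_diff_left span_diff)

lemma weight_lattice_add:
  "\<mu> \<in> weight_lattice \<alpha> I \<Longrightarrow> \<nu> \<in> weight_lattice \<alpha> I \<Longrightarrow> \<mu> + \<nu> \<in> weight_lattice \<alpha> I"
  by (auto simp: weight_lattice_iff inner_add_left span_add)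

lemma weyl_vector_lattice: "\<rho> \<in> weight_lattice \<alpha> I"
  by (auto simp: weight_lattice_iff weyl_vector_coroot)
    (auto simp: weyl_vector_def intro!: span_sum fund_weight_span)

lemma weyl_group_lattice:
  assumes "w \<in> W" "\<mu> \<in> weight_lattice \<alpha> I"
  shows "w \<mu> \<in> weight_lattice \<alpha> I"
  using assms
proof (induction arbitrary: \<mu> rule: weyl_group_induct)
  case (step w j)
  have "s j \<mu> \<bullet> coroot (\<alpha> k) \<in> \<int>" if "k \<in> I" for k
  proof -
    have "\<alpha> j \<bullet> coroot (\<alpha> k) \<in> \<int>"
      using root_system simple_in that \<open>j \<in> I\<close> unfolding root_system_def by blast
    then show ?thesis
      using \<open>j \<in> I\<close> \<open>\<mu> \<in> weight_lattice \<alpha> I\<close> that by (simp add: root_reflection_def inner_diff_left weight_lattice_iff)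
  qed
  moreover have "s j \<mu> \<in> span (\<alpha> ` I)"
    using \<open>j \<in> I\<close> \<open>\<mu> \<in> weight_lattice \<alpha> I\<close> by (simp add: root_reflection_def weight_lattice_iff span_diff span_scale span_base)
  ultimately have "s j \<mu> \<in> weight_lattice \<alpha> I" by (simp add: weight_lattice_iff)
  then show ?case using step by simp
qed simp

text \<open>Cauchy-Schwarz bounds the integer coordinates. The finiteness turns the norm on the
  lattice into an induction measure, the number of shorter lattice vectors.\<close>

lemma finite_lattice_norm_less: "finite {\<mu> \<in> weight_lattice \<alpha> I. norm \<mu> < r}"
proof -
  define N where "N j = \<lceil>r * norm (coroot (\<alpha> j))\<rceil>" for j
  have "{\<mu> \<in> weight_lattice \<alpha> I. norm \<mu> < r} \<subseteq>
      (\<lambda>m. \<Sum>j\<in>I. of_int (m j) *\<^sub>R \<omega> j) ` (PiE I (\<lambda>j. {- N j..N j}))"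
  proof clarify
    fix \<mu> assume \<mu>: "\<mu> \<in> weight_lattice \<alpha> I" "norm \<mu> < r"
    then obtain m :: "'i \<Rightarrow> int" where m: "\<mu> = (\<Sum>j\<in>I. of_int (m j) *\<^sub>R \<omega> j)"
      by (auto simp: weight_lattice_def)
    have "m k \<in> {- N k..N k}" if "k \<in> I" for k
    proof -
      have "\<bar>of_int (m k)\<bar> = \<bar>\<mu> \<bullet> coroot (\<alpha> k)\<bar>" using weight_coroot[OF that] by (simp add: m)
      also have "\<dots> \<le> norm \<mu> * norm (coroot (\<alpha> k))" by (rule Cauchy_Schwarz_ineq2)
      also have "\<dots> \<le> r * norm (coroot (\<alpha> k))" using \<mu>(2) by (intro mult_right_mono) auto
      also have "\<dots> \<le> of_int (N k)" by (simp add: N_def)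
      finally have "\<bar>m k\<bar> \<le> N k" by linarith
      then show ?thesis by auto
    qed
    then have "restrict m I \<in> PiE I (\<lambda>j. {- N j..N j})" by auto
    moreover have "\<mu> = (\<Sum>j\<in>I. of_int (restrict m I j) *\<^sub>R \<omega> j)" by (simp add: m)
    ultimately show "\<mu> \<in> (\<lambda>m. \<Sum>j\<in>I. of_int (m j) *\<^sub>R \<omega> j) ` (PiE I (\<lambda>j. {- N j..N j}))"
      by blast
  qed
  moreover have "finite (PiE I (\<lambda>j. {- N j..N j}))" using finite_I by (intro finite_PiE) auto
  ultimately show ?thesis using finite_surj by blast
qed

text \<open>Take the orbit element with the largest pairing with \<open>\<rho>\<close>; a negative
  pairing with a simple coroot would let the reflection increase it.\<close>

lemma orbit_dominant_representative:
  obtains w where "w \<in> W" "\<And>j. j \<in> I \<Longrightarrow> w \<mu> \<bullet> coroot (\<alpha> j) \<ge> 0"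
proof -
  have "W \<noteq> {}" using weyl_group.one by blast
  then obtain w where w: "w \<in> W" and max: "\<And>u. u \<in> W \<Longrightarrow> u \<mu> \<bullet> \<rho> \<le> w \<mu> \<bullet> \<rho>"
    using ex_is_arg_min_if_finite[OF finite_weyl_group[OF root_system], of "\<lambda>w. - (w \<mu> \<bullet> \<rho>)"]
    by (auto simp: is_arg_min_linorder)
  have "w \<mu> \<bullet> coroot (\<alpha> j) \<ge> 0" if "j \<in> I" for j
  proof -
    have "(s j \<circ> w) \<mu> \<bullet> \<rho> \<le> w \<mu> \<bullet> \<rho>"
      using max[OF weyl_group.step[OF simple_in[OF that] w]] .
    then have "0 \<le> (w \<mu> \<bullet> coroot (\<alpha> j)) * (\<alpha> j \<bullet> \<rho>)"
      by (simp add: root_reflection_def inner_diff_left)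
    then show ?thesis using simple_weyl_vector_pos[OF that] by (simp add: zero_le_mult_iff)
  qed
  then show thesis using that w by blast
qed

text \<open>Multiplying \<open>alternant \<Phi> \<rho>\<close> by the orbit sum of a dominant weight \<open>\<nu>\<close> gives
  \<open>alternant \<Phi> (\<rho> + \<nu>)\<close> plus alternants at shorter weights, so divisibility by
  \<open>alternant \<Phi> \<rho>\<close> follows by induction on the norm.\<close>

lemma alternant_divisible:
  assumes "\<mu> \<in> weight_lattice \<alpha> I"
  shows "\<exists>\<theta>. Poly_Mapping.keys \<theta> \<subseteq> weight_lattice \<alpha> I \<and> alternant \<Phi> \<rho> * \<theta> = alternant \<Phi> \<mu>"
  using assms
proof (induction "card {\<xi> \<in> weight_lattice \<alpha> I. norm \<xi> < norm \<mu>}" arbitrary: \<mu> rule: less_induct)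
  case less
  let ?\<Lambda> = "weight_lattice \<alpha> I"
  let ?div = "\<lambda>\<mu>. \<exists>\<theta>. Poly_Mapping.keys \<theta> \<subseteq> ?\<Lambda> \<and> alternant \<Phi> \<rho> * \<theta> = alternant \<Phi> \<mu>"
  have IH: "?div \<xi>" if "\<xi> \<in> ?\<Lambda>" "norm \<xi> < norm \<mu>" for \<xi>
  proof (rule less.hyps)
    show "card {\<kappa> \<in> ?\<Lambda>. norm \<kappa> < norm \<xi>} < card {\<kappa> \<in> ?\<Lambda>. norm \<kappa> < norm \<mu>}"
      using that finite_lattice_norm_less by (intro psubset_card_mono) auto
  qed (rule that)
  obtain w where w: "w \<in> W" and dom: "\<And>j. j \<in> I \<Longrightarrow> w \<mu> \<bullet> coroot (\<alpha> j) \<ge> 0"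
    using orbit_dominant_representative by blast
  define y where "y = w \<mu>"
  have y\<Lambda>: "y \<in> ?\<Lambda>" using weyl_group_lattice[OF w] less.prems by (simp add: y_def)
  have ny: "norm y = norm \<mu>" using weyl_group_inner[OF w, of \<mu> \<mu>] by (simp add: y_def norm_eq)
  have "?div y"
  \<comment> \<open>On a wall the alternant vanishes. Off the walls a dominant lattice weight pairs
    with every simple coroot to at least 1, so subtracting \<open>\<rho>\<close> keeps it
    dominant.\<close>
  proof (cases "\<exists>k\<in>I. y \<bullet> coroot (\<alpha> k) = 0")
    case True
    then obtain k where "k \<in> I" "s k y = y" by (auto simp: root_reflection_def)
    then have "alternant \<Phi> y = 0" using alternant_fixed zero_notin simple_in by blast
    then show ?thesis by (intro exI[of _ 0]) simp
  next
    case False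
    define \<nu> where "\<nu> = y - \<rho>"
    have \<nu>\<Lambda>: "\<nu> \<in> ?\<Lambda>" by (simp add: \<nu>_def weight_lattice_diff y\<Lambda> weyl_vector_lattice)
    have \<nu>dom: "\<nu> \<bullet> coroot (\<alpha> j) \<ge> 0" if "j \<in> I" for j
    proof -
      have "y \<bullet> coroot (\<alpha> j) \<in> \<int>" using y\<Lambda> that by (simp add: weight_lattice_iff)
      then obtain n where n: "y \<bullet> coroot (\<alpha> j) = of_int n" by (rule Ints_cases)
      moreover have "y \<bullet> coroot (\<alpha> j) > 0" using False dom[OF that] that by (force simp: y_def)
      ultimately have "n \<ge> 1" by simp
      then show ?thesis by (simp add: \<nu>_def inner_diff_left weyl_vector_coroot that n)
    qed
    define S where "S = (\<lambda>u. u \<nu>) ` W"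
    have finS: "finite S" using finite_weyl_group[OF root_system] by (simp add: S_def)
    have \<nu>S: "\<nu> \<in> S" unfolding S_def by (rule image_eqI[of _ _ id]) (auto intro: weyl_group.intros)
    have S\<Lambda>: "S \<subseteq> ?\<Lambda>" using weyl_group_lattice \<nu>\<Lambda> by (auto simp: S_def)
    have bij: "bij_betw (s j) S S" if "j \<in> I" for j
    proof (rule bij_betw_byWitness[where f' = "s j"])
      have "s j (u \<nu>) \<in> S" if "u \<in> W" for u
        unfolding S_def using weyl_group.step[OF simple_in[OF \<open>j \<in> I\<close>] that]
        by (intro image_eqI[of _ _ "s j \<circ> u"]) auto
      then show "s j ` S \<subseteq> S" and "s j ` S \<subseteq> S" by (auto simp: S_def)
    qed (simp_all add: root_reflection_idem)
    have "alternant \<Phi> \<rho> * (\<Sum>\<xi>\<in>S. Poly_Mapping.single \<xi> 1) = (\<Sum>\<xi>\<in>S. alternant \<Phi> (\<rho> + \<xi>))"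
      by (rule alternant_mult_invariant) (rule sum.reindex_bij_betw[OF bij])
    also have "\<dots> = alternant \<Phi> y + (\<Sum>\<xi>\<in>S - {\<nu>}. alternant \<Phi> (\<rho> + \<xi>))"
      using sum.remove[OF finS \<nu>S, of "\<lambda>\<xi>. alternant \<Phi> (\<rho> + \<xi>)"] by (simp add: \<nu>_def)
    finally have eq: "alternant \<Phi> y = alternant \<Phi> \<rho> * (\<Sum>\<xi>\<in>S. Poly_Mapping.single \<xi> 1) -
        (\<Sum>\<xi>\<in>S - {\<nu>}. alternant \<Phi> (\<rho> + \<xi>))" by simp
    have "?div (\<rho> + \<xi>)" if \<xi>: "\<xi> \<in> S - {\<nu>}" for \<xi>
    proof (rule IH)
      show "\<rho> + \<xi> \<in> ?\<Lambda>" using \<xi> S\<Lambda> by (auto intro: weight_lattice_add weyl_vector_lattice)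
      obtain u where u: "u \<in> W" "\<xi> = u \<nu>" using \<xi> by (auto simp: S_def)
      \<comment> \<open>\<open>\<nu>\<close> and \<open>\<xi>\<close> have equal length, so the
        lengths of \<open>\<rho> + \<nu>\<close> and \<open>\<rho> + \<xi>\<close> differ only
        through the inner products with \<open>\<rho>\<close>, and these favor
        \<open>\<nu>\<close>.\<close>
      have "(\<nu> - \<xi>) \<bullet> \<rho> > 0"
        using dominant_minus_image[OF u(1) \<nu>dom] \<xi> u by (intro positive_weyl_vector) auto
      moreover have "\<xi> \<bullet> \<xi> = \<nu> \<bullet> \<nu>" using weyl_group_inner u by simp
      ultimately have "(\<rho> + \<xi>) \<bullet> (\<rho> + \<xi>) < (\<rho> + \<nu>) \<bullet> (\<rho> + \<nu>)"
        using inner_commute[of \<rho> \<xi>] inner_commute[of \<rho> \<nu>]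
        by (simp add: inner_add_left inner_add_right inner_diff_left)
      then show "norm (\<rho> + \<xi>) < norm \<mu>"
        unfolding ny[symmetric] by (simp add: norm_lt \<nu>_def)
    qed
    then obtain \<theta> where \<theta>: "\<And>\<xi>. \<xi> \<in> S - {\<nu>} \<Longrightarrow>
        Poly_Mapping.keys (\<theta> \<xi>) \<subseteq> ?\<Lambda> \<and> alternant \<Phi> \<rho> * \<theta> \<xi> = alternant \<Phi> (\<rho> + \<xi>)"
      by metis
    define \<eta> where "\<eta> = (\<Sum>\<xi>\<in>S. Poly_Mapping.single \<xi> 1) - (\<Sum>\<xi>\<in>S - {\<nu>}. \<theta> \<xi>)"
    have "alternant \<Phi> \<rho> * \<eta> = alternant \<Phi> y"
      using \<theta> by (simp add: \<eta>_def right_diff_distrib sum_distrib_left eq)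
    moreover have "Poly_Mapping.keys \<eta> \<subseteq> ?\<Lambda>"
    proof -
      have "Poly_Mapping.keys (\<Sum>\<xi>\<in>S. Poly_Mapping.single \<xi> (1::int)) \<subseteq> ?\<Lambda>"
        by (rule order_trans[OF keys_sum]) (use S\<Lambda> in auto)
      moreover have "Poly_Mapping.keys (\<Sum>\<xi>\<in>S - {\<nu>}. \<theta> \<xi>) \<subseteq> ?\<Lambda>"
        by (rule order_trans[OF keys_sum]) (use \<theta> in blast)
      ultimately show ?thesis
        unfolding \<eta>_def by (intro order_trans[OF keys_diff] Un_least)
    qed
    ultimately show ?thesis by blast
  qed
  then obtain \<theta> where \<theta>: "Poly_Mapping.keys \<theta> \<subseteq> ?\<Lambda>" "alternant \<Phi> \<rho> * \<theta> = alternant \<Phi> y" by blast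
  from alternant_weyl_group[OF zero_notin w, of \<mu>] show ?case
  proof
    assume "alternant \<Phi> (w \<mu>) = alternant \<Phi> \<mu>"
    then show ?thesis using \<theta> by (auto simp: y_def)
  next
    assume "alternant \<Phi> (w \<mu>) = - alternant \<Phi> \<mu>"
    then show ?thesis using \<theta> by (intro exI[of _ "- \<theta>"]) (simp add: y_def)
  qed
qed

end

text \<open>For \<open>k\<close> in \<open>I - J\<close> the weight \<open>\<omega> k\<close> is
  orthogonal to the span of the simple roots in \<open>J\<close>, so pairing a root of the subsystem
  with it shows that its coefficient at \<open>\<alpha> k\<close> is 0.\<close>

lemma based_root_system_subsystem:
  assumes "root_system \<Phi>" "simple_roots \<Phi> I \<alpha>" "J \<subseteq> I"
  shows "based_root_system (subsystem \<Phi> \<alpha> J) J \<alpha>"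
proof
  interpret based_root_system \<Phi> I \<alpha> using assms by unfold_locales
  let ?\<Psi> = "subsystem \<Phi> \<alpha> J"
  have refl: "root_reflection a b \<in> ?\<Psi>" if "a \<in> ?\<Psi>" "b \<in> ?\<Psi>" for a b
    using that root_reflection_root[of a b]
    by (auto simp: subsystem_def) (auto simp: root_reflection_def intro: span_diff span_scale)
  have "root_reflection a ` ?\<Psi> = ?\<Psi>" if "a \<in> ?\<Psi>" for a
  proof
    show "root_reflection a ` ?\<Psi> \<subseteq> ?\<Psi>" using refl that by blast
    show "?\<Psi> \<subseteq> root_reflection a ` ?\<Psi>" using refl[OF that] by (metis image_eqI root_reflection_idem subsetI)
  qed
  then show "root_system ?\<Psi>"
    using assms(1) unfolding root_system_def by (auto simp: subsystem_def)
  have J: "finite J" using finite_I assms(3) finite_subset by blast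
  show "simple_roots ?\<Psi> J \<alpha>"
    unfolding simple_roots_def
  proof (intro conjI ballI)
    show "inj_on \<alpha> J" using inj_simple assms(3) inj_on_subset by blast
    show "\<alpha> ` J \<subseteq> ?\<Psi>" using simple_in assms(3) by (auto simp: subsystem_def intro: span_base)
    show "independent (\<alpha> ` J)" using independent_simple assms(3) by (meson image_mono independent_mono)
    fix b assume b: "b \<in> ?\<Psi>"
    obtain c :: "'b \<Rightarrow> nat" where c: "b = (\<Sum>i\<in>I. real (c i) *\<^sub>R \<alpha> i) \<or>
        b = - (\<Sum>i\<in>I. real (c i) *\<^sub>R \<alpha> i)"
      using b root_coeffs[of b] unfolding subsystem_def by blast
    define e :: real where "e = (if b = (\<Sum>i\<in>I. real (c i) *\<^sub>R \<alpha> i) then 1 else -1)"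
    have e: "e = 1 \<or> e = -1" and bc: "b = e *\<^sub>R (\<Sum>i\<in>I. real (c i) *\<^sub>R \<alpha> i)"
      using c by (auto simp: e_def)
    have "c k = 0" if k: "k \<in> I - J" for k
    proof -
      have "\<omega> k \<bullet> x = 0" if "x \<in> span (\<alpha> ` J)" for x
        using k assms(3) that orthogonal_to_span[of x "\<alpha> ` J" "\<omega> k"]
        by (force simp: orthogonal_def inner_commute simple_fund_weight)
      then have "b \<bullet> \<omega> k = 0" using b by (simp add: subsystem_def inner_commute)
      moreover have "b \<bullet> \<omega> k = e * (real (c k) * ((\<alpha> k \<bullet> \<alpha> k) / 2))"
        using k finite_I by (simp add: bc inner_sum_left simple_fund_weight if_distrib cong: if_cong)
      ultimately show ?thesis using e simple_nonzero[of k] k by auto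
    qed
    then have "(\<Sum>i\<in>I. real (c i) *\<^sub>R \<alpha> i) = (\<Sum>i\<in>J. real (c i) *\<^sub>R \<alpha> i)"
      using finite_I assms(3) by (intro sum.mono_neutral_right) auto
    then show "\<exists>c::'b \<Rightarrow> nat. b = (\<Sum>i\<in>J. real (c i) *\<^sub>R \<alpha> i) \<or> b = - (\<Sum>i\<in>J. real (c i) *\<^sub>R \<alpha> i)"
      using bc e by auto
  qed (rule J)
qed

lemma bialternant:
  assumes "root_system \<Phi>" "simple_roots \<Phi> I \<alpha>" "J \<subseteq> I" "\<nu> \<in> weight_lattice \<alpha> J"
  shows "alternant (subsystem \<Phi> \<alpha> J) (weyl_vector \<alpha> J) * bialternant \<Phi> \<alpha> J \<nu> =
    alternant (subsystem \<Phi> \<alpha> J) (\<nu> + weyl_vector \<alpha> J)"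
proof -
  interpret J: based_root_system "subsystem \<Phi> \<alpha> J" J \<alpha>
    using based_root_system_subsystem assms by blast
  have "\<nu> + weyl_vector \<alpha> J \<in> weight_lattice \<alpha> J"
    using assms J.weight_lattice_add J.weyl_vector_lattice by blast
  then have "\<exists>!\<theta>. Poly_Mapping.keys \<theta> \<subseteq> weight_lattice \<alpha> J \<and>
      alternant (subsystem \<Phi> \<alpha> J) (weyl_vector \<alpha> J) * \<theta> =
      alternant (subsystem \<Phi> \<alpha> J) (\<nu> + weyl_vector \<alpha> J)"
    using J.alternant_divisible J.alternant_weyl_vector_mult_cancel by metis
  from theI'[OF this] show ?thesis by (simp add: bialternant_def)
qed

section \<open>Strings of an edge-colored poset\<close>

text \<open>A local certificate: \<open>r\<close> and \<open>d\<close> count the steps down and up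
  that remain in the string, and a string stops only where the count is 0. Being free of definite
  descriptions, it can be checked for proposed formulas, which are then identified with
  \<open>color_rank\<close> and \<open>color_depth\<close>.\<close>

definition strings :: "('x, 'i) cposet \<Rightarrow> 'i \<Rightarrow> ('x \<Rightarrow> nat) \<Rightarrow> ('x \<Rightarrow> nat) \<Rightarrow> bool" where
  "strings R i r d \<longleftrightarrow>
     (\<forall>s t. edge R i s t \<longrightarrow> s \<in> verts R \<and> t \<in> verts R \<and> r t = Suc (r s) \<and> d s = Suc (d t)) \<and>
     (\<forall>x\<in>verts R. 0 < d x \<longrightarrow> (\<exists>y. edge R i x y)) \<and>
     (\<forall>x\<in>verts R. 0 < r x \<longrightarrow> (\<exists>y. edge R i y x)) \<and>
     (\<forall>s t t'. edge R i s t \<longrightarrow> edge R i s t' \<longrightarrow> t = t') \<and>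
     (\<forall>s s' t. edge R i s t \<longrightarrow> edge R i s' t \<longrightarrow> s = s')"

lemma stringsD:
  assumes "strings R i r d"
  shows "edge R i s t \<Longrightarrow> s \<in> verts R" "edge R i s t \<Longrightarrow> t \<in> verts R"
    "edge R i s t \<Longrightarrow> r t = Suc (r s)" "edge R i s t \<Longrightarrow> d s = Suc (d t)"
    "x \<in> verts R \<Longrightarrow> 0 < d x \<Longrightarrow> \<exists>y. edge R i x y"
    "x \<in> verts R \<Longrightarrow> 0 < r x \<Longrightarrow> \<exists>y. edge R i y x"
    "edge R i s t \<Longrightarrow> edge R i s t' \<Longrightarrow> t = t'"
    "edge R i s t \<Longrightarrow> edge R i s' t \<Longrightarrow> s = s'"
  using assms unfolding strings_def by metis+

lemma strings_cong:
  assumes "strings R i r d" "\<And>x. x \<in> verts R \<Longrightarrow> r' x = r x" "\<And>x. x \<in> verts R \<Longrightarrow> d' x = d x"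
  shows "strings R i r' d'"
  unfolding strings_def
proof (intro conjI allI impI ballI)
  fix s t assume e: "edge R i s t"
  note D = stringsD(1-4)[OF assms(1) e]
  show "s \<in> verts R" "t \<in> verts R" using D by auto
  show "r' t = Suc (r' s)" "d' s = Suc (d' t)" using D assms(2,3) by auto
qed (use stringsD(5-8)[OF assms(1)] assms(2,3) in auto)

section \<open>Components of one color and their rank functions\<close>

lemma color_edges_iff: "(s, t) \<in> color_edges R i \<longleftrightarrow> edge R i s t"
  by (simp add: color_edges_def)

lemma color_comp_refl: "x \<in> verts R \<Longrightarrow> x \<in> color_comp R i x"
  by (simp add: color_comp_def)

lemma color_comp_verts: "y \<in> color_comp R i x \<Longrightarrow> y \<in> verts R"
  by (simp add: color_comp_def)

lemma color_comp_edge: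
  assumes "y \<in> color_comp R i x" "z \<in> verts R" "edge R i y z \<or> edge R i z y"
  shows "z \<in> color_comp R i x"
  using assms by (auto simp: color_comp_def color_edges_iff intro: rtrancl_into_rtrancl)

lemma color_comp_sym: "x \<in> verts R \<Longrightarrow> y \<in> color_comp R i x \<Longrightarrow> x \<in> color_comp R i y"
proof -
  have "sym ((color_edges R i \<union> (color_edges R i)\<inverse>)\<^sup>*)" by (rule sym_rtrancl) (auto simp: sym_def)
  then show "x \<in> verts R \<Longrightarrow> y \<in> color_comp R i x \<Longrightarrow> x \<in> color_comp R i y"
    by (auto simp: color_comp_def dest: symD)
qed

lemma color_comp_trans: "y \<in> color_comp R i x \<Longrightarrow> z \<in> color_comp R i y \<Longrightarrow> z \<in> color_comp R i x"
  by (auto simp: color_comp_def)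

lemma color_comp_eq: "x \<in> verts R \<Longrightarrow> y \<in> color_comp R i x \<Longrightarrow> color_comp R i y = color_comp R i x"
  using color_comp_sym color_comp_trans by (metis subsetI subset_antisym)

lemma color_comp_induct [consumes 3, case_names refl up down]:
  assumes "y \<in> color_comp R i x" "x \<in> verts R"
    and closed: "\<forall>s t. edge R i s t \<longrightarrow> s \<in> verts R \<and> t \<in> verts R"
    and "P x"
    and "\<And>y z. y \<in> color_comp R i x \<Longrightarrow> z \<in> color_comp R i x \<Longrightarrow> edge R i y z \<Longrightarrow> P y \<Longrightarrow> P z"
    and "\<And>y z. y \<in> color_comp R i x \<Longrightarrow> z \<in> color_comp R i x \<Longrightarrow> edge R i z y \<Longrightarrow> P y \<Longrightarrow> P z"
  shows "P y"
proof -
  have "(x, y) \<in> (color_edges R i \<union> (color_edges R i)\<inverse>)\<^sup>*"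
    using assms(1) by (simp add: color_comp_def)
  then have "y \<in> color_comp R i x \<and> P y"
  proof induction
    case base
    then show ?case using assms(2,4) color_comp_refl by metis
  next
    case (step y z)
    then have e: "edge R i y z \<or> edge R i z y" by (auto simp: color_edges_iff)
    then have "z \<in> color_comp R i x" using step closed color_comp_edge by metis
    then show ?case using e step assms(5,6) by blast
  qed
  then show ?thesis by simp
qed

text \<open>Along a connected component two rank functions differ by a constant, and both attain the
  minimum 0.\<close>

lemma rank_function_unique:
  assumes "x \<in> verts R" and closed: "\<forall>s t. edge R i s t \<longrightarrow> s \<in> verts R \<and> t \<in> verts R"
    and "is_rank_function (color_comp R i x) (edge R i) r l"
    and "is_rank_function (color_comp R i x) (edge R i) r' l'"
  shows "r x = r' x" "l = l'"
proof -
  let ?C = "color_comp R i x"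
  have step: "edge R i s t \<Longrightarrow> s \<in> ?C \<Longrightarrow> t \<in> ?C \<Longrightarrow> r t = r s + 1 \<and> r' t = r' s + 1" for s t
    using assms(3,4) by (auto simp: is_rank_function_def)
  have diff: "r y + r' x = r' y + r x" if "y \<in> ?C" for y
    using that assms(1) closed
  proof (induction rule: color_comp_induct)
    case (up y z)
    then show ?case using step[of y z] by simp
  next
    case (down y z)
    then show ?case using step[of z y] by simp
  qed simp
  have img: "r ` ?C = {0..l}" "r' ` ?C = {0..l'}"
    using assms(3,4) by (simp_all add: is_rank_function_def)
  have "0 \<in> r ` ?C" "0 \<in> r' ` ?C" unfolding img by simp_all
  then obtain y y' where "y \<in> ?C" "r y = 0" "y' \<in> ?C" "r' y' = 0" by (metis imageE)
  then show eq: "r x = r' x" using diff[of y] diff[of y'] by linarith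
  have "r ` ?C = r' ` ?C" using diff eq by (intro image_cong) auto
  then have "{0..l} = {0..l'}" using img by simp
  then show "l = l'" by (metis atLeastatMost_empty_iff2 atLeastAtMost_iff antisym le0 order_refl)
qed

context
  fixes R :: "('x, 'i) cposet" and i :: 'i and r d :: "'x \<Rightarrow> nat"
  assumes str: "strings R i r d"
begin

lemma strings_closed: "\<forall>s t. edge R i s t \<longrightarrow> s \<in> verts R \<and> t \<in> verts R"
  using stringsD(1,2)[OF str] by blast

lemma strings_total:
  assumes "x \<in> verts R" "y \<in> color_comp R i x"
  shows "r y + d y = r x + d x"
  using assms(2,1) strings_closed
proof (induction rule: color_comp_induct)
  case (up y z)
  then show ?case using stringsD(3,4)[OF str] by fastforce
next
  case (down y z)
  then show ?case using stringsD(3,4)[OF str] by fastforce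
qed simp

lemma strings_attain:
  assumes "x \<in> verts R" "k \<le> r x + d x"
  shows "\<exists>y\<in>color_comp R i x. r y = k"
proof -
  have up: "\<exists>y\<in>color_comp R i x. r y = r x + n" if "n \<le> d x" for n
    using that
  proof (induction n)
    case 0
    then show ?case using color_comp_refl[OF assms(1)] by auto
  next
    case (Suc n)
    then obtain y where y: "y \<in> color_comp R i x" "r y = r x + n" by auto
    then have "0 < d y" using strings_total[OF assms(1) y(1)] Suc by simp
    then obtain z where z: "edge R i y z"
      using stringsD(5)[OF str color_comp_verts[OF y(1)]] by blast
    then have "z \<in> color_comp R i x" "r z = Suc (r y)"
      using color_comp_edge[OF y(1) stringsD(2)[OF str z]] stringsD(3)[OF str z] by auto
    then show ?case using y by auto
  qed
  have down: "\<exists>y\<in>color_comp R i x. r y = r x - n" if "n \<le> r x" for n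
    using that
  proof (induction n)
    case 0
    then show ?case using color_comp_refl[OF assms(1)] by auto
  next
    case (Suc n)
    then obtain y where y: "y \<in> color_comp R i x" "r y = r x - n" by auto
    then have "0 < r y" using Suc by simp
    then obtain z where z: "edge R i z y"
      using stringsD(6)[OF str color_comp_verts[OF y(1)]] by blast
    then have "z \<in> color_comp R i x" "r y = Suc (r z)"
      using color_comp_edge[OF y(1) stringsD(1)[OF str z]] stringsD(3)[OF str z] by auto
    then show ?case using y by (intro bexI[of _ z]) auto
  qed
  show ?thesis
  proof (cases "k \<le> r x")
    case True
    then show ?thesis using down[of "r x - k"] by simp
  next
    case False
    then show ?thesis using up[of "k - r x"] assms(2) by simp
  qed
qed

lemma strings_rank_function:
  assumes "x \<in> verts R"
  shows "is_rank_function (color_comp R i x) (edge R i) r (r x + d x)"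
  unfolding is_rank_function_def
proof
  show "r ` color_comp R i x = {0..r x + d x}"
  proof
    show "r ` color_comp R i x \<subseteq> {0..r x + d x}"
      using strings_total[OF assms] by (metis atLeastAtMost_iff image_subsetI le0 le_add1)
    show "{0..r x + d x} \<subseteq> r ` color_comp R i x"
      using strings_attain[OF assms] by force
  qed
qed (use stringsD(3)[OF str] in auto)

lemma
  assumes "x \<in> verts R"
  shows strings_color_rank: "color_rank R i x = r x"
    and strings_color_length: "color_length R i x = r x + d x"
    and strings_color_depth: "color_depth R i x = d x"
proof -
  note rf = strings_rank_function[OF assms]
  show 1: "color_rank R i x = r x"
    unfolding color_rank_def
    by (rule the_equality) (use rf rank_function_unique(1)[OF assms strings_closed _ rf] in blast)+
  show 2: "color_length R i x = r x + d x"
    unfolding color_length_def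
    by (rule the_equality) (use rf rank_function_unique(2)[OF assms strings_closed _ rf] in blast)+
  show "color_depth R i x = d x" by (simp add: color_depth_def 1 2)
qed

lemma strings_chain:
  assumes "x \<in> verts R" "y \<in> color_comp R i x"
  shows "(x, y) \<in> (color_edges R i)\<^sup>* \<or> (y, x) \<in> (color_edges R i)\<^sup>*"
  using assms(2,1) strings_closed
proof (induction rule: color_comp_induct)
  case (up y z)
  then have yz: "(y, z) \<in> color_edges R i" by (simp add: color_edges_iff)
  from up consider "(x, y) \<in> (color_edges R i)\<^sup>*" | "(y, x) \<in> (color_edges R i)\<^sup>*" by blast
  then show ?case
  proof cases
    case 1
    then show ?thesis using yz by (auto intro: rtrancl_into_rtrancl)
  next
    case 2
    then show ?thesis
    proof (cases rule: converse_rtranclE)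
      case base
      then show ?thesis using yz by blast
    next
      case (step u)
      then have "edge R i y u" by (simp add: color_edges_iff)
      then have "u = z" using up stringsD(7)[OF str] by blast
      then show ?thesis using step by simp
    qed
  qed
next
  case (down y z)
  then have zy: "(z, y) \<in> color_edges R i" by (simp add: color_edges_iff)
  from down consider "(x, y) \<in> (color_edges R i)\<^sup>*" | "(y, x) \<in> (color_edges R i)\<^sup>*" by blast
  then show ?case
  proof cases
    case 1
    then show ?thesis
    proof (cases rule: rtranclE)
      case base
      then show ?thesis using zy by blast
    next
      case (step u)
      then have "edge R i u y" by (simp add: color_edges_iff)
      then have "u = z" using down stringsD(8)[OF str] by blast
      then show ?thesis using step by simp
    qed
  next
    case 2
    then show ?thesis using zy by (auto intro: converse_rtrancl_into_rtrancl)
  qed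
qed simp

lemma strings_path_rank: "(x, y) \<in> (color_edges R i)\<^sup>* \<Longrightarrow> x = y \<or> r x < r y"
proof (induction rule: rtrancl_induct)
  case (step y z)
  then show ?case using stringsD(3)[OF str, of y z] by (auto simp: color_edges_iff)
qed simp

lemma strings_rank_inj:
  assumes "x \<in> verts R" "y \<in> color_comp R i x" "r y = r x"
  shows "y = x"
  using strings_chain[OF assms(1,2)] strings_path_rank assms(3) by (metis less_irrefl)

text \<open>The map reverses the lower part \<open>c \<le> d x\<close> of the string. With
  \<open>c = 0\<close> this is the whole string, with \<open>c = Suc (n j)\<close> its violating
  part.\<close>

lemma strings_reflection:
  obtains f where "\<And>x. x \<in> verts R \<Longrightarrow> c \<le> d x \<Longrightarrow>
    f x \<in> color_comp R i x \<and> r (f x) = d x - c \<and> d (f x) = r x + c \<and> f (f x) = x"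
proof -
  define f where "f x = (SOME y. y \<in> color_comp R i x \<and> r y = d x - c)" for x
  have f: "f x \<in> color_comp R i x \<and> r (f x) = d x - c \<and> d (f x) = r x + c"
    if "x \<in> verts R" "c \<le> d x" for x
  proof -
    have "\<exists>y. y \<in> color_comp R i x \<and> r y = d x - c" using strings_attain[OF that(1), of "d x - c"] by fastforce
    from someI_ex[OF this] have *: "f x \<in> color_comp R i x \<and> r (f x) = d x - c"
      unfolding f_def .
    then show ?thesis using strings_total[OF that(1), of "f x"] that(2) by simp
  qed
  have "f (f x) = x" if x: "x \<in> verts R" "c \<le> d x" for x
  proof -
    have fx: "f x \<in> verts R" "c \<le> d (f x)" using f[OF x] color_comp_verts by fastforce+
    have "f (f x) \<in> color_comp R i x" using f[OF x] f[OF fx] color_comp_trans by metis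
    moreover have "r (f (f x)) = r x" using f[OF x] f[OF fx] by simp
    ultimately show ?thesis using strings_rank_inj x by blast
  qed
  then show thesis using that f by blast
qed

end

text \<open>A global rank function \<open>g\<close> supplies the counts as distances from its
  minimum and maximum on the component. Comparability in the chain yields the edge towards a vertex
  of larger or smaller rank, and injectivity of \<open>g\<close> on the chain makes neighbors
  unique.\<close>

lemma fibrous_strings:
  assumes "fibrous_poset I R" "i \<in> I"
  shows "strings R i (color_rank R i) (color_depth R i)"
proof -
  from assms(1) obtain g l where cp: "colored_poset I R"
    and g: "is_rank_function (verts R) (\<lambda>s t. \<exists>i. edge R i s t) g l"
    and cmp: "\<And>x y z. x \<in> verts R \<Longrightarrow> y \<in> color_comp R i x \<Longrightarrow> z \<in> color_comp R i x \<Longrightarrow>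
        (y, z) \<in> (color_edges R i)\<^sup>* \<or> (z, y) \<in> (color_edges R i)\<^sup>*"
    using assms(2) unfolding fibrous_poset_def ranked_poset_def by blast
  have fin: "finite (verts R)" and closed: "edge R i s t \<Longrightarrow> s \<in> verts R \<and> t \<in> verts R" for s t
    using cp unfolding colored_poset_def by blast+
  have step: "g t = Suc (g s)" if "edge R i s t" for s t
    using g that closed[OF that] unfolding is_rank_function_def by fastforce
  have path: "x = y \<or> g x < g y" if "(x, y) \<in> (color_edges R i)\<^sup>*" for x y
    using that
  proof (induction rule: rtrancl_induct)
    case (step y z)
    then show ?case using \<open>\<And>s t. edge R i s t \<Longrightarrow> g t = Suc (g s)\<close>[of y z]
      by (auto simp: color_edges_iff)
  qed simp
  let ?C = "color_comp R i"
  have finC: "finite (?C x)" for x using fin by (auto simp: color_comp_def)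
  have inj: "y = z" if "x \<in> verts R" "y \<in> ?C x" "z \<in> ?C x" "g y = g z" for x y z
    using cmp[OF that(1-3)] path that(4) by (metis less_irrefl)
  define r where "r x = g x - Min (g ` ?C x)" for x
  define d where "d x = Max (g ` ?C x) - g x" for x
  have bounds: "Min (g ` ?C x) \<le> g x" "g x \<le> Max (g ` ?C x)" if "x \<in> verts R" for x
    using that finC color_comp_refl by (auto intro!: Min_le Max_ge imageI)
  have C_eq: "?C s = ?C t" if "edge R i s t" for s t
    using color_comp_eq[of s R t i] color_comp_edge[OF color_comp_refl[of s R i], of t] closed[OF that] that
    by simp
  have "strings R i r d"
    unfolding strings_def
  proof (intro conjI allI impI ballI)
    fix s t assume e: "edge R i s t"
    show "s \<in> verts R" "t \<in> verts R" using closed[OF e] by auto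
    show "r t = Suc (r s)" "d s = Suc (d t)"
      using step[OF e] bounds[of s] bounds[of t] closed[OF e] C_eq[OF e] by (auto simp: r_def d_def)
  next
    fix x assume x: "x \<in> verts R" "0 < d x"
    have "Max (g ` ?C x) \<in> g ` ?C x" using finC color_comp_refl[OF x(1)] by (intro Max_in) auto
    then obtain y where y: "y \<in> ?C x" "g x < g y" using x(2) by (auto simp: d_def)
    then have "(x, y) \<in> (color_edges R i)\<^sup>*"
      using cmp[OF x(1) color_comp_refl[OF x(1)] y(1)] path[of y x] by force
    then show "\<exists>y. edge R i x y"
      using y(2) by (cases rule: converse_rtranclE) (auto simp: color_edges_iff)
  next
    fix x assume x: "x \<in> verts R" "0 < r x"
    have "Min (g ` ?C x) \<in> g ` ?C x" using finC color_comp_refl[OF x(1)] by (intro Min_in) auto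
    then obtain y where y: "y \<in> ?C x" "g y < g x" using x(2) by (auto simp: r_def)
    then have "(y, x) \<in> (color_edges R i)\<^sup>*"
      using cmp[OF x(1) color_comp_refl[OF x(1)] y(1)] path[of x y] by force
    then show "\<exists>y. edge R i y x"
      using y(2) by (cases rule: rtranclE) (auto simp: color_edges_iff)
  next
    fix s t t' assume e: "edge R i s t" "edge R i s t'"
    show "t = t'"
      using inj[of s t t'] step[OF e(1)] step[OF e(2)] closed[OF e(1)] closed[OF e(2)] C_eq[OF e(1)] C_eq[OF e(2)]
        color_comp_refl[of t R i] color_comp_refl[of t' R i] by auto
  next
    fix s s' t assume e: "edge R i s t" "edge R i s' t"
    show "s = s'"
      using inj[of t s s'] step[OF e(1)] step[OF e(2)] closed[OF e(1)] closed[OF e(2)] C_eq[OF e(1)] C_eq[OF e(2)]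
        color_comp_refl[of s R i] color_comp_refl[of s' R i] by auto
  qed
  from strings_cong[OF this strings_color_rank[OF this] strings_color_depth[OF this]]
  show ?thesis by simp
qed

section \<open>Crystals and violation colorings\<close>

text \<open>What products, relabelings and sums of components inherit. The last clause is the
  structured condition read off at each simple coroot, and \<open>g\<close> grades the edges without
  being normalized to an interval.\<close>

definition crystal :: "('i \<Rightarrow> real^'n) \<Rightarrow> 'i set \<Rightarrow> ('x, 'i) cposet \<Rightarrow> bool" where
  "crystal \<alpha> I R \<longleftrightarrow>
     finite (verts R) \<and>
     (\<forall>i s t. edge R i s t \<longrightarrow> i \<in> I) \<and>
     (\<forall>i j s t. edge R i s t \<longrightarrow> edge R j s t \<longrightarrow> i = j) \<and>
     (\<exists>g::'x \<Rightarrow> nat. \<forall>i s t. edge R i s t \<longrightarrow> g t = Suc (g s)) \<and>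
     (\<forall>i\<in>I. strings R i (color_rank R i) (color_depth R i)) \<and>
     (\<forall>i s t. \<forall>k\<in>I. edge R i s t \<longrightarrow>
        of_int (color_mult R k t) = of_int (color_mult R k s) + \<alpha> i \<bullet> coroot (\<alpha> k))"

text \<open>Every vertex outside \<open>M_set J n R\<close> is given a color \<open>j \<in> J\<close> at which it violates
  \<open>\<delta>\<^sub>j \<le> n\<^sub>j\<close>, in such a way that the color does not change along the violating part of a
  \<open>j\<close>-string. Reflecting that part of the string then cancels the violating vertices in pairs.\<close>

definition violation_coloring :: "'i set \<Rightarrow> ('i \<Rightarrow> nat) \<Rightarrow> ('x, 'i) cposet \<Rightarrow> ('x \<Rightarrow> 'i) \<Rightarrow> bool" where
  "violation_coloring J n R \<kappa> \<longleftrightarrow>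
     (\<forall>x\<in>verts R - M_set J n R. \<kappa> x \<in> J \<and> n (\<kappa> x) < color_depth R (\<kappa> x) x) \<and>
     (\<forall>j\<in>J. \<forall>x y. edge R j x y \<longrightarrow> n j < color_depth R j y \<longrightarrow> (\<kappa> x = j \<longleftrightarrow> \<kappa> y = j))"

definition splittable :: "'i set \<Rightarrow> ('x, 'i) cposet \<Rightarrow> bool" where
  "splittable I R \<longleftrightarrow> (\<forall>J n. J \<subseteq> I \<longrightarrow> (\<exists>\<kappa>. violation_coloring J n R \<kappa>))"

lemma
  assumes "crystal \<alpha> I R"
  shows crystal_finite: "finite (verts R)"
    and crystal_color: "edge R i s t \<Longrightarrow> i \<in> I"
    and crystal_color_unique: "edge R i s t \<Longrightarrow> edge R j s t \<Longrightarrow> i = j"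
    and crystal_strings: "i \<in> I \<Longrightarrow> strings R i (color_rank R i) (color_depth R i)"
    and crystal_mult: "edge R i s t \<Longrightarrow> k \<in> I \<Longrightarrow>
      of_int (color_mult R k t) = of_int (color_mult R k s) + \<alpha> i \<bullet> coroot (\<alpha> k)"
proof -
  note c = assms[unfolded crystal_def]
  show "finite (verts R)" using c by (elim conjE)
  show "edge R i s t \<Longrightarrow> i \<in> I" using c by (elim conjE) metis
  show "edge R i s t \<Longrightarrow> edge R j s t \<Longrightarrow> i = j" using c by (elim conjE) metis
  show "i \<in> I \<Longrightarrow> strings R i (color_rank R i) (color_depth R i)" using c by (elim conjE) metis
  show "edge R i s t \<Longrightarrow> k \<in> I \<Longrightarrow>
      of_int (color_mult R k t) = of_int (color_mult R k s) + \<alpha> i \<bullet> coroot (\<alpha> k)"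
    using c by (elim conjE) metis
qed

lemma crystalI:
  fixes g :: "'x \<Rightarrow> nat" and R :: "('x, 'i) cposet"
  assumes "finite (verts R)" "\<And>i s t. edge R i s t \<Longrightarrow> i \<in> I"
    and "\<And>i j s t. edge R i s t \<Longrightarrow> edge R j s t \<Longrightarrow> i = j"
    and "\<And>i s t. edge R i s t \<Longrightarrow> g t = Suc (g s)"
    and "\<And>i. i \<in> I \<Longrightarrow> strings R i (color_rank R i) (color_depth R i)"
    and "\<And>i s t k. edge R i s t \<Longrightarrow> k \<in> I \<Longrightarrow>
      of_int (color_mult R k t) = of_int (color_mult R k s) + \<alpha> i \<bullet> coroot (\<alpha> k)"
  shows "crystal \<alpha> I R"
  unfolding crystal_def using assms by (intro conjI exI[of _ g]) auto

lemma crystal_step: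
  assumes "crystal \<alpha> I R"
  obtains g :: "'x \<Rightarrow> nat" where "\<And>i s t. edge (R :: ('x, 'i) cposet) i s t \<Longrightarrow> g t = Suc (g s)"
  using assms[unfolded crystal_def] that by (elim conjE exE) metis

lemma crystal_verts:
  assumes "crystal \<alpha> I R" "edge R i s t"
  shows "s \<in> verts R" "t \<in> verts R"
  using stringsD(1,2)[OF crystal_strings[OF assms(1) crystal_color[OF assms]] assms(2)] by auto

lemma (in based_root_system) vertex_weight_coroot:
  "k \<in> I \<Longrightarrow> vertex_weight \<alpha> I R x \<bullet> coroot (\<alpha> k) = of_int (color_mult R k x)"
  unfolding vertex_weight_def by (rule weight_coroot)

lemma (in based_root_system) fibrous_structured_crystal:
  fixes R :: "('x, 'i) cposet"
  assumes "structured_poset \<alpha> I R" "fibrous_poset I R"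
  shows "crystal \<alpha> I R"
proof -
  have cp: "colored_poset I R"
    and wt: "\<And>i s t. edge R i s t \<Longrightarrow> vertex_weight \<alpha> I R s + \<alpha> i = vertex_weight \<alpha> I R t"
    using assms(1) unfolding structured_poset_def ranked_poset_def by simp_all
  obtain g l where g: "is_rank_function (verts R) (\<lambda>s t. \<exists>i. edge R i s t) g l"
    using assms(1) unfolding structured_poset_def ranked_poset_def by blast
  have "finite (verts R)" and e: "\<And>i s t. edge R i s t \<Longrightarrow> i \<in> I \<and> s \<in> verts R \<and> t \<in> verts R"
    and "\<And>i j s t. edge R i s t \<Longrightarrow> edge R j s t \<Longrightarrow> i = j"
    using cp unfolding colored_poset_def by blast+
  moreover have "g t = Suc (g s)" if "edge R i s t" for i s t
    using g that e[OF that] unfolding is_rank_function_def by fastforce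
  moreover have "of_int (color_mult R k t) = of_int (color_mult R k s) + \<alpha> i \<bullet> coroot (\<alpha> k)"
    if "edge R i s t" "k \<in> I" for i s t k
    using arg_cong[OF wt[OF that(1)], of "\<lambda>v. v \<bullet> coroot (\<alpha> k)"] that(2)
    by (simp add: inner_add_left vertex_weight_coroot)
  ultimately show ?thesis
    using fibrous_strings[OF assms(2)] by (intro crystalI[of R I g \<alpha>]) metis+
qed

section \<open>Violation colorings of primary posets\<close>

lemma primary_fibrous: "primary_poset I R \<Longrightarrow> fibrous_poset I R"
  by (simp add: primary_poset_def)

lemma primary_chain:
  assumes "primary_poset I R" "i \<in> I" "x \<in> verts R" "color_comp R i x = c ` {0..l}"
    "\<forall>k<l. edge R i (c k) (c (Suc k))" "2 \<le> l" "j \<in> I - {i}" "k < l" "2 \<le> color_length R j (c k)"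
  shows "color_depth R j (c k) = 0"
  using assms(1)[unfolded primary_poset_def, THEN conjunct2, rule_format, OF assms(2-4)] assms(5-9)
  by blast

text \<open>The primary condition at a single vertex: positive depth in color \<open>i\<close> says
  that \<open>x\<close> is not the top of its chain, hence is some \<open>c k\<close> with
  \<open>k < l\<close>.\<close>

lemma primary_depth:
  assumes "primary_poset I R" "i \<in> I" "j \<in> I" "i \<noteq> j" "x \<in> verts R"
    and "2 \<le> color_length R i x" "0 < color_depth R i x" "2 \<le> color_length R j x"
  shows "color_depth R j x = 0"
proof -
  let ?r = "color_rank R i" and ?d = "color_depth R i"
  have str: "strings R i ?r ?d"
    by (rule fibrous_strings[OF primary_fibrous[OF assms(1)] assms(2)])
  define l where "l = ?r x + ?d x"
  have len: "color_length R i x = l" using strings_color_length[OF str assms(5)] by (simp add: l_def)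
  \<comment> \<open>The chain is enumerated by rank, so that the index of a vertex is its
    \<open>?r\<close> value.\<close>
  define c where "c k = (SOME y. y \<in> color_comp R i x \<and> ?r y = k)" for k
  have c: "c k \<in> color_comp R i x \<and> ?r (c k) = k" if "k \<le> l" for k
  proof -
    have "\<exists>y. y \<in> color_comp R i x \<and> ?r y = k"
      using strings_attain[OF str assms(5)] that unfolding l_def by blast
    from someI_ex[OF this] show ?thesis unfolding c_def .
  qed
  have uniq: "y = c (?r y)" if "y \<in> color_comp R i x" for y
  proof -
    have "?r y \<le> l" using strings_total[OF str assms(5) that] by (simp add: l_def)
    from c[OF this] show ?thesis
      using strings_rank_inj[OF str color_comp_verts[of "c (?r y)" R i x]] that
        color_comp_eq[OF assms(5), of "c (?r y)" i] by simp
  qed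
  have "color_comp R i x = c ` {0..l}"
  proof
    show "c ` {0..l} \<subseteq> color_comp R i x" using c by auto
    show "color_comp R i x \<subseteq> c ` {0..l}"
    proof
      fix y assume y: "y \<in> color_comp R i x"
      have "?r y \<le> l" using strings_total[OF str assms(5) y] by (simp add: l_def)
      then show "y \<in> c ` {0..l}" using uniq[OF y] by (intro image_eqI[of _ _ "?r y"]) auto
    qed
  qed
  moreover have "edge R i (c k) (c (Suc k))" if "k < l" for k
  proof -
    have ck: "c k \<in> color_comp R i x" "?r (c k) = k" using c[of k] that by auto
    then have "0 < ?d (c k)" using strings_total[OF str assms(5), of "c k"] that by (simp add: l_def)
    then obtain y where y: "edge R i (c k) y"
      using stringsD(5)[OF str color_comp_verts[OF ck(1)]] by blast
    then have "y \<in> color_comp R i x" using color_comp_edge[OF ck(1)] stringsD(2)[OF str] by blast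
    moreover have "?r y = Suc k" using stringsD(3)[OF str y] ck by simp
    ultimately show ?thesis using uniq y by metis
  qed
  moreover have "2 \<le> l" using assms(6) len by simp
  moreover have xc: "x = c (?r x)" using uniq[OF color_comp_refl[OF assms(5)]] .
  moreover have "?r x < l" using assms(7) by (simp add: l_def)
  ultimately show ?thesis
    using primary_chain[OF assms(1,2,5), of c l j "?r x"] assms(3,4,8) by simp
qed

text \<open>By \<open>primary_depth\<close> a vertex has at most one violated color whose string has
  length at least 2, and the coloring prefers it. An edge between two violating vertices has depth
  at least 2 at its lower end, so its string is of this kind and both ends get its color. In shorter
  strings the violating part is a single vertex, and any choice is consistent.\<close>

lemma primary_splittable:
  assumes "primary_poset I R"
  shows "splittable I R"
  unfolding splittable_def
proof (intro allI impI)
  fix J and n :: "_ \<Rightarrow> nat" assume J: "J \<subseteq> I"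
  have str: "strings R i (color_rank R i) (color_depth R i)" if "i \<in> I" for i
    by (rule fibrous_strings[OF primary_fibrous[OF assms] that])
  define long where "long x j \<longleftrightarrow> j \<in> J \<and> 2 \<le> color_length R j x \<and> n j < color_depth R j x" for x j
  define \<kappa> where "\<kappa> x = (if \<exists>j. long x j then SOME j. long x j
    else SOME j. j \<in> J \<and> n j < color_depth R j x)" for x
  have long: "\<kappa> x = j" if "long x j" "x \<in> verts R" for x j
  proof -
    have l: "long x (\<kappa> x)" using that(1) someI_ex[of "long x"] by (auto simp: \<kappa>_def)
    show ?thesis
    proof (rule ccontr)
      assume ne: "\<kappa> x \<noteq> j"
      have "color_depth R (\<kappa> x) x = 0"
        by (rule primary_depth[OF assms, of j "\<kappa> x" x]) (use that l J ne in \<open>auto simp: long_def\<close>)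
      then show False using l by (simp add: long_def)
    qed
  qed
  have "\<kappa> x \<in> J \<and> n (\<kappa> x) < color_depth R (\<kappa> x) x" if "x \<in> verts R - M_set J n R" for x
  proof (cases "\<exists>j. long x j")
    case True
    then have "long x (\<kappa> x)" using someI_ex[of "long x"] by (simp add: \<kappa>_def)
    then show ?thesis by (simp add: long_def)
  next
    case False
    have "\<exists>j. j \<in> J \<and> n j < color_depth R j x" using that by (auto simp: M_set_def not_le)
    from someI_ex[OF this] show ?thesis using False by (simp add: \<kappa>_def)
  qed
  moreover have "\<kappa> x = j \<and> \<kappa> y = j" if "j \<in> J" "edge R j x y" "n j < color_depth R j y" for j x y
  proof -
    note S = str[OF subsetD[OF J \<open>j \<in> J\<close>]]
    note v = stringsD(1,2)[OF S that(2)] and d = stringsD(3,4)[OF S that(2)]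
    have "color_length R j x \<ge> 2" "color_length R j y \<ge> 2"
      using d that(3) strings_color_length[OF S v(1)] strings_color_length[OF S v(2)] by auto
    then have "long x j" "long y j" using that d by (auto simp: long_def)
    then show ?thesis using long v by blast
  qed
  ultimately show "\<exists>\<kappa>. violation_coloring J n R \<kappa>"
    unfolding violation_coloring_def by blast
qed

section \<open>Crystal products\<close>

lemma edge_crystal_product:
  "edge (crystal_product A B) i (x, y) (x', y') \<longleftrightarrow>
     edge A i x x' \<and> y \<in> verts B \<and> y = y' \<and> color_depth B i y \<le> color_rank A i x \<or>
     x \<in> verts A \<and> x = x' \<and> edge B i y y' \<and> color_rank A i x < color_depth B i y"
  by (simp add: crystal_product_def)

lemma verts_crystal_product: "verts (crystal_product A B) = verts A \<times> verts B"
  by (simp add: crystal_product_def)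

text \<open>The signature rule: \<open>color_rank A i x\<close> cancels against
  \<open>color_depth B i y\<close>, and truncated subtraction leaves the excess on whichever side is
  larger.\<close>

lemma strings_crystal_product:
  assumes "strings A i (color_rank A i) (color_depth A i)"
    and "strings B i (color_rank B i) (color_depth B i)"
  shows "strings (crystal_product A B) i
    (\<lambda>(x, y). color_rank B i y + (color_rank A i x - color_depth B i y))
    (\<lambda>(x, y). color_depth A i x + (color_depth B i y - color_rank A i x))"
    (is "strings ?P i ?r ?d")
proof -
  note A = stringsD[OF assms(1)] and B = stringsD[OF assms(2)]
  have e: "fst p \<in> verts A \<and> snd p \<in> verts B \<and> fst q \<in> verts A \<and> snd q \<in> verts B \<and>
      ?r q = Suc (?r p) \<and> ?d p = Suc (?d q)" if "edge ?P i p q" for p q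
    using that A(1-4) B(1-4) by (cases p; cases q) (fastforce simp: edge_crystal_product)
  show ?thesis
    unfolding strings_def
  proof (intro conjI allI impI ballI)
    fix p q assume "edge ?P i p q"
    from e[OF this] show "p \<in> verts ?P" "q \<in> verts ?P" "?r q = Suc (?r p)" "?d p = Suc (?d q)"
      by (auto simp: verts_crystal_product mem_Times_iff)
  next
    fix p assume p: "p \<in> verts ?P" "0 < ?d p"
    obtain x y where xy: "p = (x, y)" by (cases p)
    show "\<exists>q. edge ?P i p q"
    proof (cases "color_depth B i y \<le> color_rank A i x")
      case True
      then have "0 < color_depth A i x" using p(2) xy by simp
      then obtain x' where "edge A i x x'" using A(5) p(1) xy by (auto simp: verts_crystal_product)
      then show ?thesis using True p(1) xy
        by (intro exI[of _ "(x', y)"]) (simp add: edge_crystal_product verts_crystal_product)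
    next
      case False
      then obtain y' where "edge B i y y'"
        using B(5)[of y] p(1) xy by (auto simp: verts_crystal_product)
      then show ?thesis using False p(1) xy
        by (intro exI[of _ "(x, y')"]) (simp add: edge_crystal_product verts_crystal_product)
    qed
  next
    fix p assume p: "p \<in> verts ?P" "0 < ?r p"
    obtain x y where xy: "p = (x, y)" by (cases p)
    show "\<exists>q. edge ?P i q p"
    \<comment> \<open>Strictness is needed here because the predecessor \<open>x'\<close> has rank
      one less and must still satisfy the non-strict edge condition. Otherwise the predecessor in
      \<open>B\<close> has depth one more, which makes its edge condition strict.\<close>
    proof (cases "color_depth B i y < color_rank A i x")
      case True
      then obtain x' where x': "edge A i x' x" using A(6)[of x] p(1) xy by (auto simp: verts_crystal_product)
      then show ?thesis using True p(1) xy A(3)[OF x']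
        by (intro exI[of _ "(x', y)"]) (simp add: edge_crystal_product verts_crystal_product)
    next
      case False
      then have "0 < color_rank B i y" using p(2) xy by simp
      then obtain y' where y': "edge B i y' y"
        using B(6)[of y] p(1) xy by (auto simp: verts_crystal_product)
      then show ?thesis using False p(1) xy B(4)[OF y']
        by (intro exI[of _ "(x, y')"]) (simp add: edge_crystal_product verts_crystal_product)
    qed
  next
    fix p q q' assume "edge ?P i p q" "edge ?P i p q'"
    then show "q = q'" using A(7) B(7)
      by (cases p; cases q; cases q') (auto simp: edge_crystal_product)
  next
    fix p p' q assume "edge ?P i p q" "edge ?P i p' q"
    then show "p = p'" using A(3,8) B(4,8)
      by (cases p; cases p'; cases q) (fastforce simp: edge_crystal_product)
  qed
qed

context
  fixes A :: "('x, 'i) cposet" and B :: "('y, 'i) cposet" and \<alpha> :: "'i \<Rightarrow> real^'n" and I :: "'i set"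
  assumes A: "crystal \<alpha> I A" and B: "crystal \<alpha> I B"
begin

lemma
  assumes "i \<in> I" "x \<in> verts A" "y \<in> verts B"
  shows crystal_product_depth: "color_depth (crystal_product A B) i (x, y) =
      color_depth A i x + (color_depth B i y - color_rank A i x)"
    and crystal_product_mult: "color_mult (crystal_product A B) i (x, y) =
      color_mult A i x + color_mult B i y"
proof -
  note S = strings_crystal_product[OF crystal_strings[OF A assms(1)] crystal_strings[OF B assms(1)]]
  have v: "(x, y) \<in> verts (crystal_product A B)" using assms by (simp add: verts_crystal_product)
  show 1: "color_depth (crystal_product A B) i (x, y) =
      color_depth A i x + (color_depth B i y - color_rank A i x)"
    using strings_color_depth[OF S v] by simp
  have 2: "color_rank (crystal_product A B) i (x, y) =
      color_rank B i y + (color_rank A i x - color_depth B i y)"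
    using strings_color_rank[OF S v] by simp
  show "color_mult (crystal_product A B) i (x, y) = color_mult A i x + color_mult B i y"
    by (simp add: color_mult_def 1 2)
qed

lemma crystal_crystal_product: "crystal \<alpha> I (crystal_product A B)"
proof -
  let ?P = "crystal_product A B"
  obtain g h where g: "\<And>i s t. edge A i s t \<Longrightarrow> g t = Suc (g s)" and h: "\<And>i s t. edge B i s t \<Longrightarrow> h t = Suc (h s)"
    using crystal_step[OF A] crystal_step[OF B] by metis
  have "finite (verts ?P)"
    using crystal_finite[OF A] crystal_finite[OF B] by (simp add: verts_crystal_product)
  moreover have col: "i \<in> I" if "edge ?P i p q" for i p q
    using that crystal_color[OF A] crystal_color[OF B]
    by (cases p; cases q) (auto simp: edge_crystal_product)
  moreover have "i = j" if "edge ?P i p q" "edge ?P j p q" for i j p q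
  proof -
    \<comment> \<open>This excludes that one pair of vertices is joined both by an edge in the first
      coordinate and by one in the second.\<close>
    have "\<not> edge A i x x" "\<not> edge B i y y" for i x y
      using g[of i x x] h[of i y y] by auto
    then show ?thesis
      using that crystal_color_unique[OF A] crystal_color_unique[OF B]
      by (cases p; cases q) (auto simp: edge_crystal_product)
  qed
  moreover have "(g (fst q) + h (snd q)) = Suc (g (fst p) + h (snd p))" if "edge ?P i p q" for i p q
    using that g h by (cases p; cases q) (fastforce simp: edge_crystal_product)
  moreover have str: "strings ?P i (color_rank ?P i) (color_depth ?P i)" if "i \<in> I" for i
  proof -
    note S = strings_crystal_product[OF crystal_strings[OF A that] crystal_strings[OF B that]]
    show ?thesis by (rule strings_cong[OF S strings_color_rank[OF S] strings_color_depth[OF S]])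
  qed
  moreover have "of_int (color_mult ?P k q) = of_int (color_mult ?P k p) + \<alpha> i \<bullet> coroot (\<alpha> k)"
    if "edge ?P i p q" "k \<in> I" for i p q k
  proof -
    obtain x y x' y' where pq: "p = (x, y)" "q = (x', y')" by (cases p; cases q)
    have v: "x \<in> verts A" "y \<in> verts B" "x' \<in> verts A" "y' \<in> verts B"
      using stringsD(1,2)[OF str[OF col[OF that(1)]] that(1)] pq by (auto simp: verts_crystal_product)
    show ?thesis
      using that crystal_mult[OF A _ that(2)] crystal_mult[OF B _ that(2)]
      by (auto simp: pq edge_crystal_product crystal_product_mult v)
  qed
  ultimately show ?thesis
    by (intro crystalI[of ?P I "\<lambda>p. g (fst p) + h (snd p)" \<alpha>]) metis+
qed

text \<open>A violation of \<open>x\<close> persists in the pair, since the product depth is at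
  least that of \<open>x\<close>. If \<open>x\<close> satisfies the bound \<open>n\<close>, then the
  pair violates it at \<open>j\<close> exactly when \<open>y\<close> violates \<open>m x\<close>
  there, so a coloring of \<open>B\<close> for that bound applies.\<close>

lemma splittable_crystal_product:
  assumes "splittable I A" "splittable I B"
  shows "splittable I (crystal_product A B)"
  unfolding splittable_def
proof (intro allI impI)
  fix J and n :: "_ \<Rightarrow> nat" assume J: "J \<subseteq> I"
  let ?P = "crystal_product A B"
  obtain \<kappa>A where \<kappa>A: "violation_coloring J n A \<kappa>A"
    using assms(1) J unfolding splittable_def by blast
  have "\<forall>n. \<exists>\<kappa>. violation_coloring J n B \<kappa>"
    using assms(2) J unfolding splittable_def by blast
  then obtain \<kappa>B where \<kappa>B: "\<And>n. violation_coloring J n B (\<kappa>B n)" by metis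
  \<comment> \<open>For \<open>x\<close> in \<open>M_set J n A\<close> and \<open>j\<close> in
    \<open>J\<close> the integer is nonnegative, so \<open>nat\<close> loses nothing.\<close>
  define m where "m x j = nat (int (n j) + color_mult A j x)" for x j
  define \<kappa> where "\<kappa> = (\<lambda>(x, y). if x \<in> M_set J n A then \<kappa>B (m x) y else \<kappa>A x)"
  have m: "int (m x j) = int (n j) + int (color_rank A j x) - int (color_depth A j x)"
    if "x \<in> M_set J n A" "j \<in> J" for x j
    using that by (auto simp: m_def color_mult_def M_set_def)
  have dep: "n j < color_depth ?P j (x, y) \<longleftrightarrow> m x j < color_depth B j y"
    if "x \<in> M_set J n A" "y \<in> verts B" "j \<in> J" for x y j
  proof -
    have "color_depth A j x \<le> n j" "x \<in> verts A" using that by (auto simp: M_set_def)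
    then show ?thesis
      using m[OF that(1,3)] crystal_product_depth[of j x y] that J by (auto simp: subset_iff)
  qed
  have "violation_coloring J n ?P \<kappa>"
    unfolding violation_coloring_def
  proof (intro conjI ballI allI impI)
    fix p assume p: "p \<in> verts ?P - M_set J n ?P"
    obtain x y where xy: "p = (x, y)" by (cases p)
    have v: "x \<in> verts A" "y \<in> verts B" using p xy by (auto simp: verts_crystal_product)
    have "\<kappa> p \<in> J \<and> n (\<kappa> p) < color_depth ?P (\<kappa> p) p"
    proof (cases "x \<in> M_set J n A")
      case True
      have "\<exists>j\<in>J. n j < color_depth ?P j (x, y)" using p by (auto simp: xy M_set_def not_le)
      then have "y \<notin> M_set J (m x) B" using dep[OF True v(2)] by (auto simp: M_set_def not_le)
      then have "\<kappa>B (m x) y \<in> J \<and> m x (\<kappa>B (m x) y) < color_depth B (\<kappa>B (m x) y) y"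
        using \<kappa>B[of "m x"] v(2) unfolding violation_coloring_def by blast
      then show ?thesis using dep[OF True v(2)] True by (simp add: \<kappa>_def xy)
    next
      case False
      then have "\<kappa>A x \<in> J \<and> n (\<kappa>A x) < color_depth A (\<kappa>A x) x"
        using \<kappa>A v(1) unfolding violation_coloring_def by blast
      then show ?thesis using False J crystal_product_depth[of "\<kappa>A x" x y] v
        by (auto simp: \<kappa>_def xy)
    qed
    then show "\<kappa> p \<in> J" "n (\<kappa> p) < color_depth ?P (\<kappa> p) p" by auto
  next
    fix j p q assume j: "j \<in> J" and e: "edge ?P j p q" and nq: "n j < color_depth ?P j q"
    obtain x y x' y' where pq: "p = (x, y)" "q = (x', y')" by (cases p; cases q)
    have jI: "j \<in> I" using j J by blast
    note SA = crystal_strings[OF A jI] and SB = crystal_strings[OF B jI]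
    from e consider (left) "edge A j x x'" "y \<in> verts B" "y' = y" "color_depth B j y \<le> color_rank A j x"
      | (right) "x \<in> verts A" "x' = x" "edge B j y y'" "color_rank A j x < color_depth B j y"
      by (auto simp: pq edge_crystal_product)
    then show "\<kappa> p = j \<longleftrightarrow> \<kappa> q = j"
    proof cases
      case left
      \<comment> \<open>Along an edge in the first factor the depth of \<open>y\<close> is fully
        cancelled, so the violation at \<open>q\<close> is one of \<open>x'\<close>, and hence also
        of the deeper \<open>x\<close>. Both ends are colored by \<open>\<kappa>A\<close>.\<close>
      note s = stringsD(1-4)[OF SA left(1)]
      have "n j < color_depth A j x'"
        using nq left s crystal_product_depth[OF jI s(2) left(2)] by (simp add: pq)
      moreover from this have "x \<notin> M_set J n A" "x' \<notin> M_set J n A"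
        using s j by (auto simp: M_set_def intro!: bexI[of _ j])
      ultimately show ?thesis
        using \<kappa>A j left(1) unfolding violation_coloring_def by (simp add: pq \<kappa>_def)
    next
      case right
      note s = stringsD(1-4)[OF SB right(3)]
      show ?thesis
      proof (cases "x \<in> M_set J n A")
        case True
        then have "m x j < color_depth B j y'" using dep[OF True s(2) j] nq right by (simp add: pq)
        then show ?thesis
          using \<kappa>B[of "m x"] j right True unfolding violation_coloring_def
          by (simp add: pq \<kappa>_def)
      qed (use right in \<open>simp add: pq \<kappa>_def\<close>)
    qed
  qed
  then show "\<exists>\<kappa>. violation_coloring J n ?P \<kappa>" by blast
qed

end

section \<open>Coverings\<close>

text \<open>A common setting for relabelings and for sums of components, including repeated ones,
  where \<open>p\<close> is not injective. Lifting asks only for some edge of the right color at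
  \<open>s\<close>: where strings of \<open>T\<close> have unique neighbors, its image is the given
  edge.\<close>

definition covering :: "('y \<Rightarrow> 'x) \<Rightarrow> ('y, 'i) cposet \<Rightarrow> ('x, 'i) cposet \<Rightarrow> bool" where
  "covering p R T \<longleftrightarrow>
     finite (verts R) \<and> p ` verts R \<subseteq> verts T \<and>
     (\<forall>i s t. edge R i s t \<longrightarrow> s \<in> verts R \<and> t \<in> verts R \<and> edge T i (p s) (p t)) \<and>
     (\<forall>i. \<forall>s\<in>verts R. \<forall>z. edge T i (p s) z \<longrightarrow> (\<exists>t. edge R i s t)) \<and>
     (\<forall>i. \<forall>t\<in>verts R. \<forall>z. edge T i z (p t) \<longrightarrow> (\<exists>s. edge R i s t)) \<and>
     (\<forall>i s t t'. edge R i s t \<longrightarrow> edge R i s t' \<longrightarrow> p t = p t' \<longrightarrow> t = t') \<and>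
     (\<forall>i s s' t. edge R i s t \<longrightarrow> edge R i s' t \<longrightarrow> p s = p s' \<longrightarrow> s = s')"

lemma coveringD:
  assumes "covering p R T"
  shows "finite (verts R)" "x \<in> verts R \<Longrightarrow> p x \<in> verts T"
    "edge R i s t \<Longrightarrow> s \<in> verts R" "edge R i s t \<Longrightarrow> t \<in> verts R"
    "edge R i s t \<Longrightarrow> edge T i (p s) (p t)"
    "s \<in> verts R \<Longrightarrow> edge T i (p s) z \<Longrightarrow> \<exists>t. edge R i s t"
    "t \<in> verts R \<Longrightarrow> edge T i z (p t) \<Longrightarrow> \<exists>s. edge R i s t"
    "edge R i s t \<Longrightarrow> edge R i s t' \<Longrightarrow> p t = p t' \<Longrightarrow> t = t'"
    "edge R i s t \<Longrightarrow> edge R i s' t \<Longrightarrow> p s = p s' \<Longrightarrow> s = s'"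
  using assms unfolding covering_def by (elim conjE, (simp; fail | metis image_subset_iff))+

lemma covering_strings:
  assumes "covering p R T" "strings T i r d"
  shows "strings R i (r \<circ> p) (d \<circ> p)"
proof -
  note c = coveringD[OF assms(1)] and s = stringsD[OF assms(2)]
  show ?thesis
    unfolding strings_def
  proof (intro conjI allI impI ballI)
    fix x y assume e: "edge R i x y"
    show "x \<in> verts R" "y \<in> verts R" using c(3,4)[OF e] .
    show "(r \<circ> p) y = Suc ((r \<circ> p) x)" "(d \<circ> p) x = Suc ((d \<circ> p) y)"
      using s(3,4)[OF c(5)[OF e]] by simp_all
  next
    fix x assume x: "x \<in> verts R" "0 < (d \<circ> p) x"
    then obtain z where "edge T i (p x) z" using s(5)[OF c(2)] by auto
    then show "\<exists>y. edge R i x y" using c(6) x by blast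
  next
    fix x assume x: "x \<in> verts R" "0 < (r \<circ> p) x"
    then obtain z where "edge T i z (p x)" using s(6)[OF c(2)] by auto
    then show "\<exists>y. edge R i y x" using c(7) x by blast
  next
    fix x y y' assume e: "edge R i x y" "edge R i x y'"
    show "y = y'" using c(8)[OF e s(7)[OF c(5)[OF e(1)] c(5)[OF e(2)]]] .
  next
    fix x x' y assume e: "edge R i x y" "edge R i x' y"
    show "x = x'" using c(9)[OF e s(8)[OF c(5)[OF e(1)] c(5)[OF e(2)]]] .
  qed
qed

context
  fixes p :: "'y \<Rightarrow> 'x" and R :: "('y, 'i) cposet" and T :: "('x, 'i) cposet"
    and \<alpha> :: "'i \<Rightarrow> real^'n" and I :: "'i set"
  assumes p: "covering p R T" and T: "crystal \<alpha> I T"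
begin

lemma
  assumes "i \<in> I" "x \<in> verts R"
  shows covering_depth: "color_depth R i x = color_depth T i (p x)"
    and covering_mult: "color_mult R i x = color_mult T i (p x)"
proof -
  note S = covering_strings[OF p crystal_strings[OF T assms(1)]]
  show "color_depth R i x = color_depth T i (p x)" "color_mult R i x = color_mult T i (p x)"
    using strings_color_depth[OF S assms(2)] strings_color_rank[OF S assms(2)]
    by (simp_all add: color_mult_def)
qed

lemma covering_crystal: "crystal \<alpha> I R"
proof -
  note c = coveringD[OF p]
  obtain g where g: "\<And>i s t. edge T i s t \<Longrightarrow> g t = Suc (g s)" using crystal_step[OF T] by metis
  have "strings R i (color_rank R i) (color_depth R i)" if "i \<in> I" for i
  proof -
    note S = covering_strings[OF p crystal_strings[OF T that]]
    show ?thesis by (rule strings_cong[OF S strings_color_rank[OF S] strings_color_depth[OF S]])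
  qed
  moreover have "of_int (color_mult R k t) = of_int (color_mult R k s) + \<alpha> i \<bullet> coroot (\<alpha> k)"
    if "edge R i s t" "k \<in> I" for i s t k
    using crystal_mult[OF T c(5)[OF that(1)] that(2)] covering_mult[OF that(2)] c(3,4)[OF that(1)] by simp
  moreover have "i = j" if "edge R i s t" "edge R j s t" for i j s t
    using crystal_color_unique[OF T c(5)[OF that(1)] c(5)[OF that(2)]] .
  moreover have "i \<in> I" if "edge R i s t" for i s t
    using crystal_color[OF T c(5)[OF that]] .
  moreover have "(g \<circ> p) t = Suc ((g \<circ> p) s)" if "edge R i s t" for i s t
    using g[OF c(5)[OF that]] by simp
  ultimately show ?thesis
    using c(1) by (intro crystalI[of R I "g \<circ> p" \<alpha>]) metis+
qed

lemma covering_splittable: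
  assumes "splittable I T"
  shows "splittable I R"
  unfolding splittable_def
proof (intro allI impI)
  fix J and n :: "_ \<Rightarrow> nat" assume J: "J \<subseteq> I"
  note c = coveringD[OF p]
  obtain \<kappa> where \<kappa>: "violation_coloring J n T \<kappa>"
    using assms J unfolding splittable_def by blast
  have "violation_coloring J n R (\<kappa> \<circ> p)"
    unfolding violation_coloring_def
  proof (intro conjI ballI allI impI)
    fix x assume x: "x \<in> verts R - M_set J n R"
    then have "p x \<in> verts T - M_set J n T"
      using c(2) covering_depth J by (auto simp: M_set_def subset_iff)
    then have "\<kappa> (p x) \<in> J \<and> n (\<kappa> (p x)) < color_depth T (\<kappa> (p x)) (p x)"
      using \<kappa> unfolding violation_coloring_def by blast
    then show "(\<kappa> \<circ> p) x \<in> J" "n ((\<kappa> \<circ> p) x) < color_depth R ((\<kappa> \<circ> p) x) x"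
      using x covering_depth J by auto
  next
    fix j x y assume "j \<in> J" "edge R j x y" "n j < color_depth R j y"
    moreover from this have "n j < color_depth T j (p y)"
      using covering_depth[of j y] c(4) J by auto
    ultimately show "(\<kappa> \<circ> p) x = j \<longleftrightarrow> (\<kappa> \<circ> p) y = j"
      using \<kappa> c(5) unfolding violation_coloring_def comp_def by blast
  qed
  then show "\<exists>\<kappa>. violation_coloring J n R \<kappa>" by blast
qed

end

section \<open>Coverings from relabelings and sums of components\<close>

lemma covering_relabel:
  assumes "finite (verts R)" "\<And>i s t. edge R i s t \<Longrightarrow> s \<in> verts R \<and> t \<in> verts R"
    and "\<And>x. x \<in> verts R \<Longrightarrow> g (f x) = x"
  shows "covering g (relabel f R) R"
  unfolding covering_def relabel_def using assms
  by (auto simp: image_subset_iff; metis)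

lemma finite_disjoint_sum:
  assumes "\<And>C. C \<in> set Cs \<Longrightarrow> finite (verts C)"
  shows "finite (verts (disjoint_sum Cs))"
proof -
  have "verts (disjoint_sum Cs) = Sigma {..<length Cs} (\<lambda>k. verts (Cs ! k))"
    by (auto simp: disjoint_sum_def)
  then show ?thesis using assms by auto
qed

lemma verts_connected_comp:
  "verts (connected_comp T x) = {y \<in> verts T. (x, y) \<in> (hasse_edges T \<union> (hasse_edges T)\<inverse>)\<^sup>*}"
  by (simp add: connected_comp_def Let_def)

lemma edge_connected_comp:
  "edge (connected_comp T x) i s t \<longleftrightarrow>
     s \<in> verts (connected_comp T x) \<and> t \<in> verts (connected_comp T x) \<and> edge T i s t"
  by (simp add: connected_comp_def Let_def)

lemma connected_comp_closed:
  assumes "edge T i s t" "s \<in> verts T" "t \<in> verts T"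
  shows "s \<in> verts (connected_comp T x) \<longleftrightarrow> t \<in> verts (connected_comp T x)"
proof -
  have "(s, t) \<in> hasse_edges T \<union> (hasse_edges T)\<inverse>" "(t, s) \<in> hasse_edges T \<union> (hasse_edges T)\<inverse>"
    using assms(1) by (auto simp: hasse_edges_def)
  then show ?thesis
    using assms by (auto simp: verts_connected_comp intro: rtrancl_into_rtrancl)
qed

text \<open>Components are closed under edges in both directions, so an edge of \<open>T\<close> at
  a vertex of a copy lies in that same copy.\<close>

lemma covering_disjoint_sum:
  assumes "crystal \<alpha> I T" "set Cs \<subseteq> connected_comp T ` verts T"
  shows "covering snd (disjoint_sum Cs) T"
proof -
  have comp: "\<exists>x. Cs ! k = connected_comp T x" if "k < length Cs" for k
    using assms(2) that by (auto simp: subset_iff dest!: nth_mem)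
  have fin: "finite (verts (disjoint_sum Cs))"
    using assms(2) crystal_finite[OF assms(1)]
    by (intro finite_disjoint_sum) (auto simp: verts_connected_comp subset_iff)
  have edge_iff: "edge (disjoint_sum Cs) i (k, s) (k', t) \<longleftrightarrow>
      k = k' \<and> k < length Cs \<and> s \<in> verts (Cs ! k) \<and> t \<in> verts (Cs ! k) \<and> edge T i s t" for i k k' s t
    using comp[of k] by (auto simp: disjoint_sum_def edge_connected_comp)
  have vert_iff: "(k, s) \<in> verts (disjoint_sum Cs) \<longleftrightarrow> k < length Cs \<and> s \<in> verts (Cs ! k)" for k s
    by (simp add: disjoint_sum_def)
  have sub: "s \<in> verts T" if "k < length Cs" "s \<in> verts (Cs ! k)" for k s
    using comp[OF that(1)] that(2) by (auto simp: verts_connected_comp)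
  have closed: "s \<in> verts (Cs ! k) \<longleftrightarrow> t \<in> verts (Cs ! k)" if "k < length Cs" "edge T i s t" for k i s t
    using comp[OF that(1)] connected_comp_closed[OF that(2) crystal_verts[OF assms(1) that(2)]] by auto
  show ?thesis
    unfolding covering_def
  proof (intro conjI allI impI ballI)
    show "snd ` verts (disjoint_sum Cs) \<subseteq> verts T" using sub by (auto simp: vert_iff)
  next
    fix i u v assume e: "edge (disjoint_sum Cs) i u v"
    obtain k s k' t where uv: "u = (k, s)" "v = (k', t)" by (cases u; cases v)
    show "u \<in> verts (disjoint_sum Cs)" "v \<in> verts (disjoint_sum Cs)" "edge T i (snd u) (snd v)"
      using e by (auto simp: uv edge_iff vert_iff)
  next
    fix i u z assume u: "u \<in> verts (disjoint_sum Cs)" and e: "edge T i (snd u) z"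
    obtain k s where uk: "u = (k, s)" by (cases u)
    show "\<exists>v. edge (disjoint_sum Cs) i u v"
      using u e closed[of k i s z] by (intro exI[of _ "(k, z)"]) (simp add: uk edge_iff vert_iff)
  next
    fix i u z assume u: "u \<in> verts (disjoint_sum Cs)" and e: "edge T i z (snd u)"
    obtain k s where uk: "u = (k, s)" by (cases u)
    show "\<exists>v. edge (disjoint_sum Cs) i v u"
      using u e closed[of k i z s] by (intro exI[of _ "(k, z)"]) (simp add: uk edge_iff vert_iff)
  next
    fix i u v v' assume "edge (disjoint_sum Cs) i u v" "edge (disjoint_sum Cs) i u v'" "snd v = snd v'"
    then show "v = v'" by (cases u; cases v; cases v') (simp add: edge_iff)
  next
    fix i u u' v assume "edge (disjoint_sum Cs) i u v" "edge (disjoint_sum Cs) i u' v" "snd u = snd u'"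
    then show "u = u'" by (cases u; cases u'; cases v) (simp add: edge_iff)
  qed (rule fin)
qed

lemma crystal_relabel:
  assumes "crystal \<alpha> I R" "\<And>x. x \<in> verts R \<Longrightarrow> g (f x) = x"
  shows "crystal \<alpha> I (relabel f R)" and "splittable I R \<Longrightarrow> splittable I (relabel f R)"
proof -
  have "covering g (relabel f R) R"
    by (rule covering_relabel) (use crystal_finite[OF assms(1)] crystal_verts[OF assms(1)] assms(2) in auto)
  then show "crystal \<alpha> I (relabel f R)" and "splittable I R \<Longrightarrow> splittable I (relabel f R)"
    using covering_crystal covering_splittable assms(1) by blast+
qed

section \<open>Iterated products, sums of components, and the return to ranked posets\<close>

lemma crystal_crystal_products:
  assumes "Rs \<noteq> []" "\<And>S. S \<in> set Rs \<Longrightarrow> crystal \<alpha> I S \<and> splittable I S"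
  shows "crystal \<alpha> I (crystal_products Rs) \<and> splittable I (crystal_products Rs)"
  using assms
proof (induction Rs rule: crystal_products.induct)
  case (1 R)
  then show ?case using crystal_relabel[of \<alpha> I R hd "\<lambda>x. [x]"] by simp
next
  case (2 R S Rs)
  let ?P = "crystal_product R (crystal_products (S # Rs))"
  have "crystal \<alpha> I R" "crystal \<alpha> I (crystal_products (S # Rs))"
    "splittable I R" "splittable I (crystal_products (S # Rs))" using 2 by auto
  then have "crystal \<alpha> I ?P" "splittable I ?P"
    using crystal_crystal_product splittable_crystal_product by blast+
  then show ?case
    using crystal_relabel[of \<alpha> I ?P "\<lambda>l. (hd l, tl l)" "\<lambda>(x, xs). x # xs"] by auto
qed simp

lemma crystal_sum_of_components:
  assumes "sum_of_components R T" "crystal \<alpha> I T" "splittable I T"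
  shows "crystal \<alpha> I R" "splittable I R" "verts R \<noteq> {}"
proof -
  obtain Cs f where Cs: "Cs \<noteq> []" "set Cs \<subseteq> connected_comp T ` verts T"
    and f: "inj_on f (verts (disjoint_sum Cs))" and R: "R = relabel f (disjoint_sum Cs)"
    using assms(1) unfolding sum_of_components_def by blast
  have cov: "covering snd (disjoint_sum Cs) T" by (rule covering_disjoint_sum[OF assms(2) Cs(2)])
  have inv: "inv_into (verts (disjoint_sum Cs)) f (f x) = x" if "x \<in> verts (disjoint_sum Cs)" for x
    using f that by simp
  note relabel = crystal_relabel[where f = f and g = "inv_into (verts (disjoint_sum Cs)) f",
      OF covering_crystal[OF cov assms(2)] inv]
  show "crystal \<alpha> I R" unfolding R by (rule relabel(1))
  show "splittable I R" unfolding R by (rule relabel(2)[OF _ covering_splittable[OF cov assms(2,3)]])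
  have "Cs ! 0 \<in> connected_comp T ` verts T" using Cs by (auto intro!: subsetD[OF Cs(2)])
  then obtain x where "x \<in> verts T" "Cs ! 0 = connected_comp T x" by blast
  then have "(0, x) \<in> verts (disjoint_sum Cs)"
    using Cs(1) by (simp add: disjoint_sum_def verts_connected_comp)
  then show "verts R \<noteq> {}" by (auto simp: R relabel_def)
qed

text \<open>The rank function is normalized to start at \<open>0\<close> on every connected component, where its
  values form an interval.\<close>

lemma crystal_ranked:
  assumes "crystal \<alpha> I R" "verts R \<noteq> {}"
  shows "ranked_poset I R"
proof -
  obtain g where g: "\<And>i s t. edge R i s t \<Longrightarrow> g t = Suc (g s)" using crystal_step[OF assms(1)] by metis
  note v = crystal_verts[OF assms(1)] and fin = crystal_finite[OF assms(1)]
  define E where "E = hasse_edges R \<union> (hasse_edges R)\<inverse>"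
  have Estep: "x \<in> verts R \<and> y \<in> verts R \<and> (g y = Suc (g x) \<or> g x = Suc (g y))" if "(x, y) \<in> E" for x y
    using that v g by (auto simp: E_def hasse_edges_def)
  have symE: "sym (E\<^sup>*)" by (rule sym_rtrancl) (auto simp: E_def sym_def)
  define K where "K x = {y \<in> verts R. (x, y) \<in> E\<^sup>*}" for x
  have finK: "finite (K x)" for x using fin by (simp add: K_def)
  have Kself: "x \<in> K x" if "x \<in> verts R" for x using that by (simp add: K_def)
  have Keq: "K x = K y" if "(x, y) \<in> E\<^sup>*" for x y
    using that symD[OF symE that] by (auto simp: K_def)
  define r where "r x = g x - Min (g ` K x)" for x
  have r: "g x = r x + Min (g ` K x)" if "x \<in> verts R" for x
    using finK Kself[OF that] by (simp add: r_def)
  have rstep: "r t = Suc (r s)" if e: "edge R i s t" for i s t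
  proof -
    have "(s, t) \<in> E" using e by (auto simp: E_def hasse_edges_def)
    then have "K s = K t" using Keq by blast
    then show ?thesis using r[OF v(1)[OF e]] r[OF v(2)[OF e]] g[OF e] by simp
  qed
  have zero: "\<exists>y. (x, y) \<in> E\<^sup>* \<and> y \<in> verts R \<and> r y = 0" if x: "x \<in> verts R" for x
  proof -
    have "Min (g ` K x) \<in> g ` K x" using finK Kself[OF x] by (intro Min_in) auto
    then obtain y where y: "y \<in> K x" "g y = Min (g ` K x)" by auto
    then have xy: "(x, y) \<in> E\<^sup>*" "y \<in> verts R" by (auto simp: K_def)
    then have "K x = K y" using Keq by blast
    then show ?thesis using y xy by (intro exI[of _ y]) (simp add: r_def)
  qed
  \<comment> \<open>Discrete intermediate values: along an undirected path \<open>r\<close> rises by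
    at most one per step, so no value is skipped.\<close>
  have ivt: "\<exists>z\<in>verts R. r z = k" if "(x, y) \<in> E\<^sup>*" "x \<in> verts R" "r x \<le> k" "k \<le> r y" for x y k
    using that(1) that(4)
  proof (induction rule: rtrancl_induct)
    case base
    then show ?case using that(2,3) by force
  next
    case (step y z)
    have z: "r z \<le> Suc (r y)" "z \<in> verts R"
      using step(2) rstep Estep[OF step(2)] by (auto simp: E_def hasse_edges_def)
    show ?case
    proof (cases "k \<le> r y")
      case True
      then show ?thesis using step.IH by simp
    next
      case False
      then have "r z = k" using z(1) step.prems by simp
      then show ?thesis using z(2) by blast
    qed
  qed
  define l where "l = Max (r ` verts R)"
  have "r ` verts R = {0..l}"
  proof
    show "r ` verts R \<subseteq> {0..l}" using fin by (auto simp: l_def)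
    show "{0..l} \<subseteq> r ` verts R"
    proof
      fix k assume k: "k \<in> {0..l}"
      have "l \<in> r ` verts R" unfolding l_def using fin assms(2) by (intro Max_in) auto
      then obtain x where x: "x \<in> verts R" "r x = l" by auto
      obtain y where y: "(x, y) \<in> E\<^sup>*" "y \<in> verts R" "r y = 0" using zero[OF x(1)] by blast
      then show "k \<in> r ` verts R" using ivt[OF symD[OF symE y(1)] y(2), of k] x k by auto
    qed
  qed
  then have rf: "is_rank_function (verts R) (\<lambda>s t. \<exists>i. edge R i s t) r l"
    using rstep by (auto simp: is_rank_function_def)
  have path: "r s < r t" if "(s, t) \<in> (hasse_edges R)\<^sup>+" for s t
    using that by (induction rule: trancl_induct) (auto simp: hasse_edges_def dest: rstep)
  have "colored_poset I R"
    unfolding colored_poset_def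
  proof (intro conjI allI impI)
    show "acyclic (hasse_edges R)" using path by (force simp: acyclic_def)
    \<comment> \<open>An edge raises \<open>r\<close> by exactly one, which leaves no room for an
      intermediate vertex.\<close>
    show "\<forall>(s, t)\<in>hasse_edges R. \<not> (\<exists>u. (s, u) \<in> (hasse_edges R)\<^sup>+ \<and> (u, t) \<in> (hasse_edges R)\<^sup>+)"
    proof clarify
      fix s t u assume "(s, t) \<in> hasse_edges R" "(s, u) \<in> (hasse_edges R)\<^sup>+" "(u, t) \<in> (hasse_edges R)\<^sup>+"
      then show False using path[of s u] path[of u t] rstep by (auto simp: hasse_edges_def)
    qed
  qed (use fin v crystal_color[OF assms(1)] crystal_color_unique[OF assms(1)] in auto)
  then show ?thesis unfolding ranked_poset_def using rf by blast
qed

lemma crystal_fibrous: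
  assumes "crystal \<alpha> I R" "verts R \<noteq> {}"
  shows "fibrous_poset I R"
  unfolding fibrous_poset_def
proof (intro conjI ballI)
  fix i x y z assume i: "i \<in> I" "x \<in> verts R" "y \<in> color_comp R i x" "z \<in> color_comp R i x"
  show "(y, z) \<in> (color_edges R i)\<^sup>* \<or> (z, y) \<in> (color_edges R i)\<^sup>*"
    using strings_chain[OF crystal_strings[OF assms(1) i(1)] color_comp_verts[OF i(3)]] i(4)
      color_comp_eq[OF i(2,3)] by simp
qed (rule crystal_ranked[OF assms])

text \<open>Expanding \<open>\<alpha> i\<close> in fundamental weights reassembles the
  coordinatewise condition of \<open>crystal\<close> into an equation of vectors.\<close>

lemma (in based_root_system) crystal_structured:
  assumes "crystal \<alpha> I R" "verts R \<noteq> {}"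
  shows "structured_poset \<alpha> I R"
  unfolding structured_poset_def
proof (intro conjI allI impI)
  fix i s t assume e: "edge R i s t"
  have i: "i \<in> I" using crystal_color[OF assms(1) e] .
  have "\<alpha> i = (\<Sum>j\<in>I. (\<alpha> i \<bullet> coroot (\<alpha> j)) *\<^sub>R \<omega> j)"
    by (rule span_coroot_expansion) (use i in \<open>auto intro: span_base\<close>)
  then have "vertex_weight \<alpha> I R s + \<alpha> i =
      (\<Sum>j\<in>I. of_int (color_mult R j s) *\<^sub>R \<omega> j + (\<alpha> i \<bullet> coroot (\<alpha> j)) *\<^sub>R \<omega> j)"
    by (simp add: vertex_weight_def sum.distrib)
  also have "\<dots> = vertex_weight \<alpha> I R t"
    unfolding vertex_weight_def
    by (rule sum.cong) (simp_all add: crystal_mult[OF assms(1) e] scaleR_add_left)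
  finally show "vertex_weight \<alpha> I R s + \<alpha> i = vertex_weight \<alpha> I R t" .
qed (rule crystal_ranked[OF assms])

section \<open>The splitting identity\<close>

text \<open>Summing over a set larger than the support gives two elements and their sum a common
  index set, from which additivity follows.\<close>

lemma ring_restrict_eq:
  assumes "finite X" "Poly_Mapping.keys \<theta> \<subseteq> X"
  shows "ring_restrict \<alpha> J \<theta> =
    (\<Sum>\<mu>\<in>X. Poly_Mapping.single (weight_restrict \<alpha> J \<mu>) (Poly_Mapping.lookup \<theta> \<mu>))"
  unfolding ring_restrict_def using assms
  by (intro sum.mono_neutral_left) (auto simp: in_keys_iff)

lemma ring_restrict_add: "ring_restrict \<alpha> J (\<theta> + \<eta>) = ring_restrict \<alpha> J \<theta> + ring_restrict \<alpha> J \<eta>"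
proof -
  let ?X = "Poly_Mapping.keys \<theta> \<union> Poly_Mapping.keys \<eta>"
  have "Poly_Mapping.keys (\<theta> + \<eta>) \<subseteq> ?X" by (rule keys_add)
  then show ?thesis
    using ring_restrict_eq[of ?X \<theta> \<alpha> J] ring_restrict_eq[of ?X \<eta> \<alpha> J] ring_restrict_eq[of ?X "\<theta> + \<eta>" \<alpha> J]
    by (simp add: lookup_add single_add sum.distrib)
qed

lemma ring_restrict_sum_single:
  "ring_restrict \<alpha> J (\<Sum>x\<in>X. Poly_Mapping.single (f x) 1) =
    (\<Sum>x\<in>X. Poly_Mapping.single (weight_restrict \<alpha> J (f x)) 1)"
proof (induction X rule: infinite_finite_induct)
  case (insert x X)
  have "ring_restrict \<alpha> J (Poly_Mapping.single (f x) 1) = Poly_Mapping.single (weight_restrict \<alpha> J (f x)) 1"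
    by (simp add: ring_restrict_def)
  then show ?case using insert by (simp add: ring_restrict_add)
qed (simp_all add: ring_restrict_def)

lemma crystal_mult_comp:
  assumes "crystal \<alpha> I R" "j \<in> I" "k \<in> I" "x \<in> verts R" "y \<in> color_comp R j x"
  shows "of_int (color_mult R k y) = of_int (color_mult R k x) +
    (real (color_rank R j y) - real (color_rank R j x)) * (\<alpha> j \<bullet> coroot (\<alpha> k))"
proof -
  note S = crystal_strings[OF assms(1,2)]
  show ?thesis
    using assms(5,4) strings_closed[OF S]
  proof (induction rule: color_comp_induct)
    case (up y z)
    then show ?case using crystal_mult[OF assms(1) up(3) assms(3)] stringsD(3)[OF S up(3)]
      by (simp add: algebra_simps)
  next
    case (down y z)
    then show ?case using crystal_mult[OF assms(1) down(3) assms(3)] stringsD(3)[OF S down(3)]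
      by (simp add: algebra_simps)
  qed simp
qed

context based_root_system
begin

text \<open>\<open>K\<close> is the full color set of the poset, while \<open>I\<close> is the index
  set of the root system at hand. The two are kept apart so that the lemmas can be used in the
  subsystem of \<open>J\<close> without restricting the poset.\<close>

lemma vertex_weight_string:
  assumes "crystal \<alpha> K R" "I \<subseteq> K" "j \<in> I" "x \<in> verts R" "y \<in> color_comp R j x"
  shows "vertex_weight \<alpha> I R y = vertex_weight \<alpha> I R x +
    (real (color_rank R j y) - real (color_rank R j x)) *\<^sub>R \<alpha> j"
proof -
  let ?c = "real (color_rank R j y) - real (color_rank R j x)"
  have "\<alpha> j = (\<Sum>k\<in>I. (\<alpha> j \<bullet> coroot (\<alpha> k)) *\<^sub>R \<omega> k)"
    by (rule span_coroot_expansion) (use assms(3) in \<open>auto intro: span_base\<close>)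
  then have "?c *\<^sub>R \<alpha> j = (\<Sum>k\<in>I. (?c * (\<alpha> j \<bullet> coroot (\<alpha> k))) *\<^sub>R \<omega> k)"
    by (metis (no_types, lifting) scaleR_scaleR scaleR_sum_right sum.cong)
  moreover have "vertex_weight \<alpha> I R y = (\<Sum>k\<in>I. (of_int (color_mult R k x) +
      ?c * (\<alpha> j \<bullet> coroot (\<alpha> k))) *\<^sub>R \<omega> k)"
    unfolding vertex_weight_def
    by (rule sum.cong) (use crystal_mult_comp[OF assms(1) _ _ assms(4,5)] assms(2,3) in auto)
  ultimately show ?thesis
    by (simp add: vertex_weight_def scaleR_add_left sum.distrib)
qed

text \<open>The pairing of \<open>\<mu> + vertex_weight \<alpha> I R x\<close> with the coroot is
  \<open>c\<close> plus rank minus depth of \<open>x\<close>, which is exactly the drop in rank from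
  \<open>x\<close> to \<open>y\<close>. The case \<open>\<mu> = 0\<close>, \<open>c = 0\<close>
  gives invariance of the weights; for a dominant weight plus \<open>\<rho>\<close> the pairing is
  \<open>c = Suc (n j)\<close>.\<close>

lemma vertex_weight_reflection:
  assumes "crystal \<alpha> K R" "I \<subseteq> K" "j \<in> I"
    and x: "x \<in> verts R" and y: "y \<in> color_comp R j x" "color_rank R j y = color_depth R j x - c"
    and c: "c \<le> color_depth R j x" "\<mu> \<bullet> coroot (\<alpha> j) = real c"
  shows "\<mu> + vertex_weight \<alpha> I R y = s j (\<mu> + vertex_weight \<alpha> I R x)"
proof -
  let ?v = "vertex_weight \<alpha> I R"
  have "(\<mu> + ?v x) \<bullet> coroot (\<alpha> j) = real c + of_int (color_mult R j x)"
    by (simp add: inner_add_left c(2) vertex_weight_coroot assms(3))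
  also have "\<dots> = - (real (color_rank R j y) - real (color_rank R j x))"
    using y(2) c(1) by (simp add: color_mult_def)
  finally show ?thesis
    using vertex_weight_string[OF assms(1-3) x y(1)] by (simp add: root_reflection_def scaleR_diff_left)
qed

lemma alternant_mult_character:
  assumes "crystal \<alpha> K R" "I \<subseteq> K"
  shows "alternant \<Phi> \<mu> * (\<Sum>x\<in>verts R. Poly_Mapping.single (vertex_weight \<alpha> I R x) 1) =
    (\<Sum>x\<in>verts R. alternant \<Phi> (\<mu> + vertex_weight \<alpha> I R x))"
proof (rule alternant_mult_invariant)
  fix j and F :: "real^'n \<Rightarrow> (real^'n) \<Rightarrow>\<^sub>0 int"
  assume j: "j \<in> I"
  let ?v = "vertex_weight \<alpha> I R"
  have S: "strings R j (color_rank R j) (color_depth R j)"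
    using crystal_strings[OF assms(1)] assms(2) j by blast
  obtain f where f: "\<And>x. x \<in> verts R \<Longrightarrow> 0 \<le> color_depth R j x \<Longrightarrow> f x \<in> color_comp R j x \<and>
      color_rank R j (f x) = color_depth R j x - 0 \<and> color_depth R j (f x) = color_rank R j x + 0 \<and> f (f x) = x"
    by (rule strings_reflection[OF S, of 0]) blast
  have fv: "f x \<in> verts R" if "x \<in> verts R" for x using f[OF that] color_comp_verts[of "f x" R j x] by simp
  have "?v (f x) = s j (?v x)" if "x \<in> verts R" for x
    using vertex_weight_reflection[OF assms j that, of "f x" 0 0] f[OF that] by simp
  then have "(\<Sum>x\<in>verts R. F (s j (?v x))) = (\<Sum>x\<in>verts R. F (?v (f x)))" by simp
  also have "\<dots> = (\<Sum>x\<in>verts R. F (?v x))"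
    by (rule sum.reindex_bij_witness[of _ f f]) (use f fv in auto)
  finally show "(\<Sum>x\<in>verts R. F (s j (?v x))) = (\<Sum>x\<in>verts R. F (?v x))" .
qed

text \<open>Depth grows downwards, so everything below a violating vertex of the string violates
  too, and the condition on single edges propagates along the path.\<close>

lemma violation_coloring_string:
  assumes "violation_coloring I n R \<kappa>" "strings R j (color_rank R j) (color_depth R j)"
    and "j \<in> I" "x \<in> verts R" "y \<in> color_comp R j x" "n j < color_depth R j x" "n j < color_depth R j y"
    and "\<kappa> x = j"
  shows "\<kappa> y = j"
proof -
  have path: "n j < color_depth R j v \<longrightarrow> (\<kappa> u = j \<longleftrightarrow> \<kappa> v = j)"
    if "(u, v) \<in> (color_edges R j)\<^sup>*" for u v
    using that
  proof (induction rule: rtrancl_induct)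
    case (step v w)
    then have "edge R j v w" by (simp add: color_edges_iff)
    then show ?case
      using step.IH stringsD(4)[OF assms(2), of v w] assms(1,3) unfolding violation_coloring_def by force
  qed simp
  show ?thesis
    using strings_chain[OF assms(2,4,5)] path[of x y] path[of y x] assms(6-8) by blast
qed

lemma violating_sum_zero:
  assumes "crystal \<alpha> K R" "I \<subseteq> K" "violation_coloring I n R \<kappa>"
    and \<mu>: "\<And>j. j \<in> I \<Longrightarrow> \<mu> \<bullet> coroot (\<alpha> j) = real (Suc (n j))"
  shows "(\<Sum>x\<in>verts R - M_set I n R. alternant \<Phi> (\<mu> + vertex_weight \<alpha> I R x)) = 0"
proof -
  let ?N = "verts R - M_set I n R" and ?A = "\<lambda>x. alternant \<Phi> (\<mu> + vertex_weight \<alpha> I R x)"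
  have S: "strings R j (color_rank R j) (color_depth R j)" if "j \<in> I" for j
    using crystal_strings[OF assms(1)] assms(2) that by blast
  have "\<forall>j\<in>I. \<exists>f. \<forall>x. x \<in> verts R \<longrightarrow> Suc (n j) \<le> color_depth R j x \<longrightarrow> f x \<in> color_comp R j x \<and>
      color_rank R j (f x) = color_depth R j x - Suc (n j) \<and>
      color_depth R j (f x) = color_rank R j x + Suc (n j) \<and> f (f x) = x"
  proof
    fix j assume "j \<in> I"
    show "\<exists>f. \<forall>x. x \<in> verts R \<longrightarrow> Suc (n j) \<le> color_depth R j x \<longrightarrow> f x \<in> color_comp R j x \<and>
      color_rank R j (f x) = color_depth R j x - Suc (n j) \<and>
      color_depth R j (f x) = color_rank R j x + Suc (n j) \<and> f (f x) = x"
      by (rule strings_reflection[OF S[OF \<open>j \<in> I\<close>], of "Suc (n j)"]) blast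
  qed
  then obtain f where f: "\<And>j x. j \<in> I \<Longrightarrow> x \<in> verts R \<Longrightarrow> Suc (n j) \<le> color_depth R j x \<Longrightarrow>
      f j x \<in> color_comp R j x \<and> color_rank R j (f j x) = color_depth R j x - Suc (n j) \<and>
      color_depth R j (f j x) = color_rank R j x + Suc (n j) \<and> f j (f j x) = x"
    by metis
  define \<tau> where "\<tau> x = f (\<kappa> x) x" for x
  have \<tau>: "\<tau> x \<in> ?N \<and> \<tau> (\<tau> x) = x \<and> ?A (\<tau> x) = - ?A x" if x: "x \<in> ?N" for x
  proof -
    have j: "\<kappa> x \<in> I" "n (\<kappa> x) < color_depth R (\<kappa> x) x"
      using assms(3) x unfolding violation_coloring_def by blast+
    have x': "x \<in> verts R" "Suc (n (\<kappa> x)) \<le> color_depth R (\<kappa> x) x" using x j by auto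
    note fx = f[OF j(1) x', folded \<tau>_def]
    have d: "n (\<kappa> x) < color_depth R (\<kappa> x) (\<tau> x)" using fx by simp
    have "\<tau> x \<in> verts R" using fx color_comp_verts[of "\<tau> x" R "\<kappa> x" x] by simp
    then have "\<tau> x \<in> ?N" using d j(1) by (auto simp: M_set_def intro!: bexI[of _ "\<kappa> x"])
    \<comment> \<open>The color must be unchanged for the second application of
      \<open>\<tau>\<close> to reflect the same part of the same string.\<close>
    moreover have "\<kappa> (\<tau> x) = \<kappa> x"
      using violation_coloring_string[OF assms(3) S[OF j(1)] j(1) x'(1) _ j(2) d] fx by blast
    then have "\<tau> (\<tau> x) = x" using fx by (simp add: \<tau>_def)
    moreover have "?A (\<tau> x) = - ?A x"
      using vertex_weight_reflection[OF assms(1,2) j(1) x'(1) _ _ x'(2) \<mu>[OF j(1)], of "\<tau> x"] fx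
        alternant_reflection[OF zero_notin simple_in[OF j(1)]] by simp
    ultimately show ?thesis by blast
  qed
  \<comment> \<open>Fixed points of \<open>\<tau>\<close> need no separate case: the total is shown
    to equal its own negative, and the coefficients are integers.\<close>
  have "(\<Sum>x\<in>?N. ?A x) = (\<Sum>x\<in>?N. ?A (\<tau> x))"
    by (rule sum.reindex_bij_witness[of _ \<tau> \<tau>]) (use \<tau> in auto)
  also have "\<dots> = - (\<Sum>x\<in>?N. ?A x)"
    using \<tau> by (simp add: sum_negf[symmetric] del: sum_negf)
  finally show ?thesis by (simp only: poly_mapping_int_eq_uminus_iff)
qed

lemma dominant_weight_coroot: "j \<in> I \<Longrightarrow> dominant_weight \<alpha> I n \<bullet> coroot (\<alpha> j) = real (n j)"
  unfolding dominant_weight_def by (rule weight_coroot)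

lemma dominant_weight_lattice: "dominant_weight \<alpha> I n \<in> weight_lattice \<alpha> I"
  unfolding weight_lattice_def dominant_weight_def by (rule range_eqI[of _ _ "\<lambda>j. int (n j)"]) simp

lemma vertex_weight_lattice: "vertex_weight \<alpha> I R x \<in> weight_lattice \<alpha> I"
  unfolding weight_lattice_def vertex_weight_def by (rule range_eqI) simp

text \<open>The bound on the depth makes each coefficient, \<open>n j\<close> plus rank minus depth,
  nonnegative, so \<open>nat\<close> is harmless.\<close>

lemma dominant_weight_add_vertex_weight:
  assumes "x \<in> M_set I n R"
  shows "dominant_weight \<alpha> I n + vertex_weight \<alpha> I R x \<in> dominant_weights \<alpha> I"
proof -
  have "dominant_weight \<alpha> I n + vertex_weight \<alpha> I R x =
      dominant_weight \<alpha> I (\<lambda>j. nat (int (n j) + color_mult R j x))"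
    unfolding dominant_weight_def vertex_weight_def sum.distrib[symmetric] scaleR_add_left[symmetric]
    by (rule sum.cong) (use assms in \<open>auto simp: M_set_def color_mult_def\<close>)
  then show ?thesis by (simp add: dominant_weights_def)
qed

end

lemma splitting_identity:
  assumes "root_system \<Phi>" "simple_roots \<Phi> I \<alpha>" "J \<subseteq> I" "crystal \<alpha> I R" "splittable I R"
  shows "bialternant \<Phi> \<alpha> J (dominant_weight \<alpha> J n) * ring_restrict \<alpha> J (WGF \<alpha> I R) =
    (\<Sum>m\<in>M_set J n R. bialternant \<Phi> \<alpha> J (dominant_weight \<alpha> J n + vertex_weight \<alpha> J R m))"
proof -
  interpret based_root_system \<Phi> I \<alpha> using assms by unfold_locales
  interpret J: based_root_system "subsystem \<Phi> \<alpha> J" J \<alpha>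
    by (rule based_root_system_subsystem[OF assms(1-3)])
  let ?A = "alternant (subsystem \<Phi> \<alpha> J)" and ?\<rho> = "weyl_vector \<alpha> J" and ?v = "vertex_weight \<alpha> J R"
  define \<nu> where "\<nu> = dominant_weight \<alpha> J n"
  obtain \<kappa> where \<kappa>: "violation_coloring J n R \<kappa>"
    using assms(3,5) unfolding splittable_def by blast
  have "weight_restrict \<alpha> J (vertex_weight \<alpha> I R x) = ?v x" for x
    unfolding weight_restrict_def vertex_weight_def[of \<alpha> J]
    by (rule sum.cong) (simp_all add: vertex_weight_coroot[OF subsetD[OF assms(3)]])
  then have wgf: "ring_restrict \<alpha> J (WGF \<alpha> I R) = (\<Sum>x\<in>verts R. Poly_Mapping.single (?v x) 1)"
    by (simp add: WGF_def ring_restrict_sum_single)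
  have \<mu>: "(\<nu> + ?\<rho>) \<bullet> coroot (\<alpha> j) = real (Suc (n j))" if "j \<in> J" for j
    using that by (simp add: \<nu>_def inner_add_left J.dominant_weight_coroot J.weyl_vector_coroot)
  have bi: "?A ?\<rho> * bialternant \<Phi> \<alpha> J \<mu> = ?A (\<mu> + ?\<rho>)" if "\<mu> \<in> weight_lattice \<alpha> J" for \<mu>
    by (rule bialternant[OF assms(1-3) that])
  have M: "M_set J n R \<subseteq> verts R" by (auto simp: M_set_def)
  have "?A ?\<rho> * (bialternant \<Phi> \<alpha> J \<nu> * ring_restrict \<alpha> J (WGF \<alpha> I R)) =
      ?A (\<nu> + ?\<rho>) * (\<Sum>x\<in>verts R. Poly_Mapping.single (?v x) 1)"
    using bi[OF J.dominant_weight_lattice, of n] by (simp add: wgf \<nu>_def mult.assoc[symmetric])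
  also have "\<dots> = (\<Sum>x\<in>verts R. ?A ((\<nu> + ?\<rho>) + ?v x))"
    by (rule J.alternant_mult_character[OF assms(4,3)])
  also have "\<dots> = (\<Sum>x\<in>verts R - M_set J n R. ?A ((\<nu> + ?\<rho>) + ?v x)) +
      (\<Sum>x\<in>M_set J n R. ?A ((\<nu> + ?\<rho>) + ?v x))"
    by (rule sum.subset_diff[OF M crystal_finite[OF assms(4)]])
  also have "\<dots> = (\<Sum>x\<in>M_set J n R. ?A ((\<nu> + ?\<rho>) + ?v x))"
    using J.violating_sum_zero[OF assms(4,3) \<kappa> \<mu>] by simp
  \<comment> \<open>Each weight lies in the lattice, so its alternant is a multiple of
    \<open>?A ?\<rho>\<close>, which can be pulled out of the sum and cancelled.\<close>
  also have "\<dots> = (\<Sum>x\<in>M_set J n R. ?A ?\<rho> * bialternant \<Phi> \<alpha> J (\<nu> + ?v x))"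
    by (rule sum.cong)
      (simp_all add: bi \<nu>_def J.weight_lattice_add J.dominant_weight_lattice J.vertex_weight_lattice add_ac)
  finally show ?thesis
    unfolding \<nu>_def[symmetric] sum_distrib_left[symmetric] by (rule J.alternant_weyl_vector_mult_cancel)
qed

theorem theorem6p5:
  fixes \<Phi> :: "(real^'n) set" and I :: "'i set" and \<alpha> :: "'i \<Rightarrow> real^'n"
    and Rs :: "('x, 'i) cposet list" and R :: "('y, 'i) cposet"
  assumes "root_system \<Phi>"
    and "simple_roots \<Phi> I \<alpha>"
    and "Rs \<noteq> []"
    and "\<And>S. S \<in> set Rs \<Longrightarrow> structured_poset \<alpha> I S \<and> primary_poset I S"
    and "sum_of_components R (crystal_products Rs)"
  shows "crystalline_splitting \<Phi> \<alpha> I R \<and>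
    (\<forall>J n. J \<subseteq> I \<longrightarrow>
       (let \<nu> = dominant_weight \<alpha> J n
        in bialternant \<Phi> \<alpha> J \<nu> * ring_restrict \<alpha> J (WGF \<alpha> I R) =
             (\<Sum>m\<in>M_set J n R. bialternant \<Phi> \<alpha> J (\<nu> + vertex_weight \<alpha> J R m))))"
proof -
  interpret based_root_system \<Phi> I \<alpha> using assms(1,2) by unfold_locales
  have "crystal \<alpha> I S \<and> splittable I S" if "S \<in> set Rs" for S
    using assms(4)[OF that] fibrous_structured_crystal primary_fibrous primary_splittable by blast
  then have T: "crystal \<alpha> I (crystal_products Rs)" "splittable I (crystal_products Rs)"
    using crystal_crystal_products[OF assms(3), of \<alpha> I] by auto
  note R = crystal_sum_of_components[OF assms(5) T]
  have identity: "bialternant \<Phi> \<alpha> J (dominant_weight \<alpha> J n) * ring_restrict \<alpha> J (WGF \<alpha> I R) =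
      (\<Sum>m\<in>M_set J n R. bialternant \<Phi> \<alpha> J (dominant_weight \<alpha> J n + vertex_weight \<alpha> J R m))"
    if "J \<subseteq> I" for J n
    by (rule splitting_identity[OF assms(1,2) that R(1,2)])
  have "\<exists>S\<subseteq>verts R. (\<forall>s\<in>S. \<nu> + vertex_weight \<alpha> J R s \<in> dominant_weights \<alpha> J) \<and>
      bialternant \<Phi> \<alpha> J \<nu> * ring_restrict \<alpha> J (WGF \<alpha> I R) =
        (\<Sum>s\<in>S. bialternant \<Phi> \<alpha> J (\<nu> + vertex_weight \<alpha> J R s))"
    if J: "J \<subseteq> I" and \<nu>: "\<nu> \<in> dominant_weights \<alpha> J" for J \<nu>
  proof -
    interpret J: based_root_system "subsystem \<Phi> \<alpha> J" J \<alpha>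
      by (rule based_root_system_subsystem[OF assms(1,2) J])
    obtain n where n: "\<nu> = dominant_weight \<alpha> J n" using \<nu> by (auto simp: dominant_weights_def)
    show ?thesis
      unfolding n
    proof (intro exI conjI ballI)
      show "M_set J n R \<subseteq> verts R" by (auto simp: M_set_def)
    qed (rule J.dominant_weight_add_vertex_weight identity[OF J], assumption?)+
  qed
  then have "crystalline_splitting \<Phi> \<alpha> I R"
    unfolding crystalline_splitting_def
    using crystal_structured[OF R(1,3)] crystal_fibrous[OF R(1,3)] by blast
  then show ?thesis using identity by (simp add: Let_def)
qed

end
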